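(* The following is a complete list of the Levi decomposable real Lie subalgebras of $\mathfrak{su}(2,1)$ up to conjugation in $\mathrm{SU}(2,1)$: (1) $\mathfrak{v}_{4,3}=\langle A_1,\;A_2,\;A_5,\;A_6\rangle$; (2) $\mathfrak{v}_{4,4}=\langle A_1,\;A_2,\;A_3,\;A_4\rangle$. That is, every Levi decomposable real subalgebra of $\mathfrak{su}(2,1)$ is conjugate under $\mathrm{SU}(2,1)$ to one of these two (both of dimension 4), and these two are not conjugate under $\mathrm{SU}(2,1)$.
   Context: Let $N=\mathrm{diag}(1,1,-1)$. $\mathfrak{su}(2,1)$ is the real Lie algebra of traceless complex $3\times3$ matrices $x$ with $-N\bar x^{t}N^{-1}=x$, and $\mathrm{SU}(2,1)$ is the group of $g\in\mathrm{SL}_3(\mathbb{C})$ with $N(\bar g^{t})^{-1}N^{-1}=g$. $\mathrm{SU}(2,1)$ acts on subalgebras by $g\cdot\mathfrak{v}=g\mathfrak{v}g^{-1}$; conjugate means lying in the same orbit. With $E_{ij}$ the matrix units, the real basis of $\mathfrak{su}(2,1)$ used is $A_1=i(E_{11}-E_{22})$, $A_2=i(E_{22}-E_{33})$, $A_3=E_{12}-E_{21}$, $A_4=i(E_{12}+E_{21})$, $A_5=E_{13}+E_{31}$, $A_6=i(E_{13}-E_{31})$, $A_7=E_{23}+E_{32}$, $A_8=i(E_{23}-E_{32})$. $\langle\cdots\rangle$ denotes the real linear span. A Lie algebra is called Levi decomposable here if it is neither solvable nor semisimple, i.e. both its Levi factor and its solvable radical are nonzero. *)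

theory Defs
  imports "HOL-Analysis.Analysis"
begin

text \<open>
  Complex $3 \times 3$ matrices are regarded throughout as a real vector space:
  \<^const>\<open>span\<close>, \<^const>\<open>subspace\<close> and \<^const>\<open>dim\<close> are the real notions.
\<close>

type_synonym cmat3 = "complex ^ 3 ^ 3"

definition cscale :: "complex \<Rightarrow> cmat3 \<Rightarrow> cmat3" where
  "cscale c x = (\<chi> i j. c * x $ i $ j)"

definition conj_transpose :: "cmat3 \<Rightarrow> cmat3" where
  "conj_transpose x = (\<chi> i j. cnj (x $ j $ i))"

definition bracket :: "cmat3 \<Rightarrow> cmat3 \<Rightarrow> cmat3" where
  "bracket x y = x ** y - y ** x"

definition E :: "3 \<Rightarrow> 3 \<Rightarrow> cmat3" where
  "E k l = (\<chi> i j. if i = k \<and> j = l then 1 else 0)"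

definition N :: cmat3 where
  "N = E 1 1 + E 2 2 - E 3 3"

definition su21 :: "cmat3 set" where
  "su21 = {x. trace x = 0 \<and> - (N ** conj_transpose x ** matrix_inv N) = x}"

definition SU21 :: "cmat3 set" where
  "SU21 = {g. det g = 1 \<and> N ** matrix_inv (conj_transpose g) ** matrix_inv N = g}"

definition act :: "cmat3 \<Rightarrow> cmat3 set \<Rightarrow> cmat3 set" where
  "act g v = (\<lambda>x. g ** x ** matrix_inv g) ` v"

definition conjugate :: "cmat3 set \<Rightarrow> cmat3 set \<Rightarrow> bool" where
  "conjugate v w \<longleftrightarrow> (\<exists>g\<in>SU21. act g v = w)"

definition lie_subalgebra :: "cmat3 set \<Rightarrow> cmat3 set \<Rightarrow> bool" where
  "lie_subalgebra v g \<longleftrightarrow>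
     v \<subseteq> g \<and> subspace v \<and> (\<forall>x\<in>v. \<forall>y\<in>v. bracket x y \<in> v)"

definition lie_ideal :: "cmat3 set \<Rightarrow> cmat3 set \<Rightarrow> bool" where
  "lie_ideal a v \<longleftrightarrow>
     a \<subseteq> v \<and> subspace a \<and> (\<forall>x\<in>v. \<forall>y\<in>a. bracket x y \<in> a)"

definition derived_algebra :: "cmat3 set \<Rightarrow> cmat3 set" where
  "derived_algebra v = span {bracket x y | x y. x \<in> v \<and> y \<in> v}"

definition lie_solvable :: "cmat3 set \<Rightarrow> bool" where
  "lie_solvable v \<longleftrightarrow> (\<exists>n. (derived_algebra ^^ n) v = {0})"

text \<open>The radical is the sum of all solvable ideals, which is the largest solvable ideal.\<close>

definition radical :: "cmat3 set \<Rightarrow> cmat3 set" where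
  "radical v = span (\<Union>{a. lie_ideal a v \<and> lie_solvable a})"

definition lie_semisimple :: "cmat3 set \<Rightarrow> bool" where
  "lie_semisimple v \<longleftrightarrow> radical v = {0}"

text \<open>
  The Levi factor is isomorphic to the quotient by the radical, so it is nonzero exactly when the
  algebra is not solvable; the radical is nonzero exactly when the algebra is not semisimple.
\<close>

definition levi_decomposable :: "cmat3 set \<Rightarrow> bool" where
  "levi_decomposable v \<longleftrightarrow> \<not> lie_solvable v \<and> \<not> lie_semisimple v"

definition A1 :: cmat3 where "A1 = cscale \<i> (E 1 1 - E 2 2)"
definition A2 :: cmat3 where "A2 = cscale \<i> (E 2 2 - E 3 3)"
definition A3 :: cmat3 where "A3 = E 1 2 - E 2 1"
definition A4 :: cmat3 where "A4 = cscale \<i> (E 1 2 + E 2 1)"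
definition A5 :: cmat3 where "A5 = E 1 3 + E 3 1"
definition A6 :: cmat3 where "A6 = cscale \<i> (E 1 3 - E 3 1)"

definition v43 :: "cmat3 set" where "v43 = span {A1, A2, A5, A6}"
definition v44 :: "cmat3 set" where "v44 = span {A1, A2, A3, A4}"

end

theory Submission
  imports Defs "HOL-Computational_Algebra.Fundamental_Theorem_Algebra"
begin

text \<open>
  The last term of the derived series of the radical of v is a nonzero abelian ideal, and it
  provides a complex line C e that v leaves invariant: an eigenspace or image of a central element,
  or else the image of a power of a nilpotent element of the ideal. If e is isotropic for the
  hermitian form of signature (2,1), then v preserves the flag of C e and its orthogonal complement,
  so v is solvable. Otherwise e is, up to SU(2,1) and scaling, the second or the third basis vector,
  and v lies in the stabiliser v43 or v44 of that line. Both stabilisers are a one-dimensional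
  centre plus a three-dimensional simple algebra, and a proper subalgebra of such an algebra is
  solvable or has no abelian ideal. The two stabilisers are told apart by the trace form: x^2 has
  trace at most 0 on v44, while A5^2 has trace 2.
\<close>

text \<open>What the ideal contributes is one identity: for \<open>x\<close> in the abelian ideal
  and \<open>y\<close> in \<open>v\<close> the bracket [x, y] lies in the ideal again, so
  \<open>x\<close> commutes with it. The obstacle is that an eigenvector common to all of
  \<open>v\<close> is wanted, while \<open>v\<close> is neither solvable nor complex, so Lie's
  theorem does not apply to it. The identity fills the gap: it makes [x, y] nilpotent, and it
  controls products such as u y u^2 with \<open>y\<close> arbitrary in \<open>v\<close>. The
  hermitian form helps to find the line only in the last case, a nilpotent element of square zero
  whose brackets with \<open>v\<close> also have square zero: the form has no isotropic plane, so
  orthogonal isotropic vectors are parallel. The stabilisers are copies of u(1,1) and u(2). A skew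
  operator that preserves a nonisotropic line preserves its orthogonal complement, which is
  indefinite for a positive line and definite for a negative one.\<close>

section \<open>Matrix arithmetic and the commutator bracket\<close>

lemma matrix_diff_ldistrib: "A ** (B - C) = A ** B - A ** C" for A :: "'a::ring_1^'n^'m"
  by (vector matrix_matrix_mult_def sum_subtractf[symmetric] algebra_simps)

lemma matrix_diff_rdistrib: "(A - B) ** C = A ** C - B ** C" for A :: "'a::ring_1^'n^'m"
  by (vector matrix_matrix_mult_def sum_subtractf[symmetric] algebra_simps)

lemma matrix_add_rdistrib: "(A + B) ** C = A ** C + B ** C" for A :: "'a::semiring_1^'n^'m"
  by (vector matrix_matrix_mult_def sum.distrib[symmetric] algebra_simps)

lemma matrix_minus_left: "(- A) ** B = - (A ** B)" for A :: "'a::ring_1^'n^'m"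
  by (vector matrix_matrix_mult_def sum_negf[symmetric])

lemma matrix_minus_right: "A ** (- B) = - (A ** B)" for A :: "'a::ring_1^'n^'m"
  by (vector matrix_matrix_mult_def sum_negf[symmetric])

lemma matrix_zero_left: "0 ** B = (0 :: 'a::semiring_1^'k^'m)"
  by (vector matrix_matrix_mult_def)

lemma matrix_zero_right: "A ** 0 = (0 :: 'a::semiring_1^'k^'m)"
  by (vector matrix_matrix_mult_def)

lemma matrix_scaleR_left: "(c *\<^sub>R A) ** B = c *\<^sub>R (A ** B)" for A :: "'a::real_algebra_1^'n^'m"
  by (vector matrix_matrix_mult_def scaleR_sum_right)

lemma matrix_scaleR_right: "A ** (c *\<^sub>R B) = c *\<^sub>R (A ** B)" for A :: "'a::real_algebra_1^'n^'m"
  by (vector matrix_matrix_mult_def scaleR_sum_right)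

lemmas matrix_ring_simps = matrix_diff_ldistrib matrix_diff_rdistrib matrix_add_ldistrib matrix_add_rdistrib
  matrix_minus_left matrix_minus_right matrix_zero_left matrix_zero_right matrix_scaleR_left matrix_scaleR_right

lemma bracket_mult_vector: "bracket x y *v w = x *v (y *v w) - y *v (x *v w)"
  by (simp add: bracket_def matrix_vector_mult_diff_rdistrib matrix_vector_mul_assoc)

lemma bracket_linear_left: "linear (\<lambda>x. bracket x y)"
  by (rule linearI) (simp_all add: bracket_def matrix_ring_simps algebra_simps)

lemma bracket_linear_right: "linear (bracket x)"
  by (rule linearI) (simp_all add: bracket_def matrix_ring_simps algebra_simps)

lemma bilinear_bracket: "bilinear bracket"
  by (simp add: bilinear_def bracket_linear_left bracket_linear_right)

lemma bracket_skew: "bracket y x = - bracket x y"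
  by (simp add: bracket_def)

lemma bracket_self [simp]: "bracket x x = 0"
  by (simp add: bracket_def)

lemma bracket_zero [simp]: "bracket 0 x = 0" "bracket x 0 = 0"
  by (simp_all add: bracket_def matrix_ring_simps)

lemma jacobi: "bracket x (bracket y z) = bracket (bracket x y) z + bracket y (bracket x z)"
  by (simp add: bracket_def matrix_ring_simps matrix_mul_assoc)

section \<open>Derived series and abelian ideals\<close>

lemma derived_algebra_subset:
  assumes "subspace w" "\<And>x y. x \<in> v \<Longrightarrow> y \<in> v \<Longrightarrow> bracket x y \<in> w"
  shows "derived_algebra v \<subseteq> w"
  unfolding derived_algebra_def using assms by (intro span_minimal) auto

lemma bracket_in_derived_algebra: "x \<in> v \<Longrightarrow> y \<in> v \<Longrightarrow> bracket x y \<in> derived_algebra v"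
  unfolding derived_algebra_def by (rule span_base) auto

lemma derived_algebra_mono: "v \<subseteq> w \<Longrightarrow> derived_algebra v \<subseteq> derived_algebra w"
  unfolding derived_algebra_def by (rule span_mono) auto

lemma subspace_derived_algebra: "subspace (derived_algebra v)"
  by (simp add: derived_algebra_def)

lemma lie_solvable_if_derived:
  assumes "(derived_algebra ^^ n) v \<subseteq> {0}" "0 \<in> v"
  shows "lie_solvable v"
proof -
  have "0 \<in> (derived_algebra ^^ n) v"
    by (cases n) (use assms subspace_0[OF subspace_derived_algebra] in auto)
  then show ?thesis using assms(1) unfolding lie_solvable_def by blast
qed

text \<open>By the Jacobi identity, bracketing with \<open>x\<close> is a derivation: it sends a
  bracket of two elements of \<open>a\<close> to a sum of two such brackets.\<close>

lemma lie_ideal_derived: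
  assumes "lie_subalgebra v g" "lie_ideal a v"
  shows "lie_ideal (derived_algebra a) v"
proof -
  have sub: "derived_algebra a \<subseteq> a"
    by (rule derived_algebra_subset) (use assms in \<open>auto simp: lie_ideal_def\<close>)
  have "bracket x y \<in> derived_algebra a" if x: "x \<in> v" and y: "y \<in> derived_algebra a" for x y
    using y unfolding derived_algebra_def
  proof (induction rule: span_induct_alt)
    case base
    show ?case using span_0 by simp
  next
    case (step c y z)
    then obtain p q where pq: "p \<in> a" "q \<in> a" "y = bracket p q" by blast
    have "bracket x y = bracket (bracket x p) q + bracket p (bracket x q)"
      unfolding pq(3) by (rule jacobi)
    also have "\<dots> \<in> derived_algebra a"
      using pq x assms(2) by (intro subspace_add subspace_derived_algebra bracket_in_derived_algebra)
        (auto simp: lie_ideal_def)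
    finally show ?case using step.IH
      by (simp add: linear_add[OF bracket_linear_right] linear_cmul[OF bracket_linear_right]
          derived_algebra_def span_add span_scale)
  qed
  then show ?thesis using assms(2) sub unfolding lie_ideal_def
    by (auto simp: subspace_derived_algebra)
qed

text \<open>The radical is spanned by the solvable ideals, so if it is nonzero, one of them is. The
  derived series below is that of this single ideal.\<close>

lemma abelian_ideal_exists:
  assumes "lie_subalgebra v g" "\<not> lie_semisimple v"
  obtains a where "lie_ideal a v" "a \<noteq> {0}" "\<And>x y. x \<in> a \<Longrightarrow> y \<in> a \<Longrightarrow> bracket x y = 0"
proof -
  have "\<exists>a. lie_ideal a v \<and> lie_solvable a \<and> a \<noteq> {0}"
  proof (rule ccontr)
    assume "\<not> ?thesis"
    then have "\<Union>{a. lie_ideal a v \<and> lie_solvable a} \<subseteq> {0}" by blast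
    then have "radical v \<subseteq> {0}" unfolding radical_def by (intro span_minimal) auto
    moreover have "0 \<in> radical v" by (simp add: radical_def span_0)
    ultimately show False using assms(2) by (auto simp: lie_semisimple_def)
  qed
  then obtain a n where a: "lie_ideal a v" "a \<noteq> {0}" "(derived_algebra ^^ n) a = {0}"
    unfolding lie_solvable_def by blast
  \<comment> \<open>Leastness makes the preceding term nonzero, and \<open>m\<close> is positive
    because \<open>a\<close> itself is nonzero.\<close>
  define m where "m = (LEAST n. (derived_algebra ^^ n) a = {0})"
  have m: "(derived_algebra ^^ m) a = {0}" unfolding m_def using a(3) by (rule LeastI)
  then obtain k where k: "m = Suc k" using a(2) by (cases m) auto
  define b where "b = (derived_algebra ^^ k) a"
  have "b \<noteq> {0}" unfolding b_def using not_less_Least[of k "\<lambda>n. (derived_algebra ^^ n) a = {0}"] k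
    by (simp add: m_def)
  moreover have "lie_ideal b v" unfolding b_def
    by (induction k) (use a lie_ideal_derived[OF assms(1)] in auto)
  moreover have "bracket x y = 0" if "x \<in> b" "y \<in> b" for x y
    using bracket_in_derived_algebra[OF that] m by (simp add: k b_def)
  ultimately show ?thesis using that by blast
qed

section \<open>Linear algebra of 3x3 matrices\<close>

lemma matrix_inv_unique:
  fixes A :: "'a::semiring_1^'n^'n"
  assumes "A ** B = mat 1" "B ** A = mat 1"
  shows "matrix_inv A = B"
proof -
  have "\<exists>A'. A ** A' = mat 1 \<and> A' ** A = mat 1" using assms by blast
  then have "A ** matrix_inv A = mat 1 \<and> matrix_inv A ** A = mat 1"
    unfolding matrix_inv_def by (rule someI_ex)
  then have "matrix_inv A = matrix_inv A ** (A ** B)" using assms by simp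
  also have "\<dots> = B" using \<open>A ** matrix_inv A = mat 1 \<and> _\<close> by (simp add: matrix_mul_assoc)
  finally show ?thesis .
qed

lemma parallel_if_minors_zero:
  fixes e f :: "'a::field^3"
  assumes "e \<noteq> 0" "e$2 * f$3 = e$3 * f$2" "e$3 * f$1 = e$1 * f$3" "e$1 * f$2 = e$2 * f$1"
  shows "\<exists>c. f = c *s e"
proof -
  have "e$1 \<noteq> 0 \<or> e$2 \<noteq> 0 \<or> e$3 \<noteq> 0" using assms(1) by (auto simp: vec_eq_iff forall_3)
  moreover have "f = (f$1 / e$1) *s e" if "e$1 \<noteq> 0"
    using that assms by (simp add: vec_eq_iff forall_3 field_simps)
  moreover have "f = (f$2 / e$2) *s e" if "e$2 \<noteq> 0"
    using that assms by (simp add: vec_eq_iff forall_3 field_simps)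
  moreover have "f = (f$3 / e$3) *s e" if "e$3 \<noteq> 0"
    using that assms by (simp add: vec_eq_iff forall_3 field_simps)
  ultimately show ?thesis by blast
qed

text \<open>Each row of \<open>t\<close> annihilates \<open>e\<close> and \<open>f\<close>, hence is
  a multiple of their cross product \<open>(x1, x2, x3)\<close>, which is nonzero. The column of
  these multipliers is \<open>d\<close>.\<close>

lemma range_line_if_kernel_plane:
  fixes t :: "'a::field^3^3"
  assumes "t *v e = 0" "t *v f = 0" "e \<noteq> 0" "\<nexists>c. f = c *s e"
  obtains d where "\<And>u. \<exists>k. t *v u = k *s d"
proof -
  define x1 where "x1 = e$2 * f$3 - e$3 * f$2"
  define x2 where "x2 = e$3 * f$1 - e$1 * f$3"
  define x3 where "x3 = e$1 * f$2 - e$2 * f$1"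
  note x_defs = x1_def x2_def x3_def
  have nz: "x1 \<noteq> 0 \<or> x2 \<noteq> 0 \<or> x3 \<noteq> 0"
    using parallel_if_minors_zero[OF assms(3), of f] assms(4) by (auto simp: x_defs)
  have e: "t$i$1 * e$1 + t$i$2 * e$2 + t$i$3 * e$3 = 0" for i
    using assms(1) by (simp add: vec_eq_iff matrix_vector_mult_def sum_3)
  have f: "t$i$1 * f$1 + t$i$2 * f$2 + t$i$3 * f$3 = 0" for i
    using assms(2) by (simp add: vec_eq_iff matrix_vector_mult_def sum_3)
  have par: "t$i$1 * x2 = t$i$2 * x1" "t$i$2 * x3 = t$i$3 * x2" "t$i$1 * x3 = t$i$3 * x1" for i
    using e[of i] f[of i] unfolding x_defs by algebra+
  have rank1: "\<exists>k. t *v u = k *s d"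
    if d: "\<And>i. t$i$1 = d$i * x1 \<and> t$i$2 = d$i * x2 \<and> t$i$3 = d$i * x3" for d u
  proof
    show "t *v u = (x1 * u$1 + x2 * u$2 + x3 * u$3) *s d"
      by (simp add: vec_eq_iff matrix_vector_mult_def sum_3 d algebra_simps)
  qed
  have "\<exists>d. \<forall>u. \<exists>k. t *v u = k *s d"
  proof -
    consider "x1 \<noteq> 0" | "x2 \<noteq> 0" | "x3 \<noteq> 0" using nz by blast
    then show ?thesis
    proof cases
      case 1
      with par show ?thesis
        by (intro exI[of _ "\<chi> i. t$i$1 / x1"] allI rank1) (simp add: field_simps)
    next
      case 2
      with par show ?thesis
        by (intro exI[of _ "\<chi> i. t$i$2 / x2"] allI rank1) (simp add: field_simps)
    next
      case 3
      with par show ?thesis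
        by (intro exI[of _ "\<chi> i. t$i$3 / x3"] allI rank1) (simp add: field_simps)
    qed
  qed
  then show ?thesis using that by blast
qed

lemma singular_kernel:
  fixes t :: "'a::field^'n^'n"
  assumes "det t = 0"
  obtains e where "e \<noteq> 0" "t *v e = 0"
proof -
  have "\<not> invertible t" using assms by (simp add: invertible_det_nz)
  then show ?thesis using that
    by (metis invertible_left_inverse matrix_left_invertible_ker)
qed

lemma cayley_hamilton_3:
  fixes z :: "complex^3^3"
  defines "s \<equiv> z$1$1 * z$2$2 - z$1$2 * z$2$1 + z$1$1 * z$3$3 - z$1$3 * z$3$1 + z$2$2 * z$3$3 - z$2$3 * z$3$2"
  shows "z ** z ** z = mat (trace z) ** (z ** z) - mat s ** z + mat (det z)"
  by (simp add: vec_eq_iff forall_3 matrix_matrix_mult_def sum_3 mat_def trace_def det_3 s_def)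
     (intro conjI; algebra)

text \<open>Newton's identities in degree three: the power sums of the eigenvalues vanish, hence so
  do the characteristic coefficients. The determinant is reached by taking the trace of the
  Cayley-Hamilton equation.\<close>

lemma nilpotent_if_traces_zero:
  fixes z :: "complex^3^3"
  assumes "trace z = 0" "trace (z ** z) = 0" "trace (z ** z ** z) = 0"
  shows "z ** z ** z = 0"
proof -
  define s where "s = z$1$1 * z$2$2 - z$1$2 * z$2$1 + z$1$1 * z$3$3 - z$1$3 * z$3$1 + z$2$2 * z$3$3 - z$2$3 * z$3$2"
  have "2 * s = trace z * trace z - trace (z ** z)"
    by (simp add: s_def trace_def matrix_matrix_mult_def sum_3 algebra_simps)
  then have s: "s = 0" using assms by simp
  have ch: "z ** z ** z = mat (det z)"
    using cayley_hamilton_3[of z] assms(1) s unfolding s_def[symmetric]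
    by (simp add: mat_0 matrix_ring_simps)
  have "trace (mat (det z) :: complex^3^3) = 3 * det z"
    by (simp add: trace_def mat_def sum_3)
  then have "det z = 0" using assms(3) ch by simp
  then show ?thesis using ch by simp
qed

text \<open>If x commutes with z = [x,y], then tr(z m) = tr([x,y] m) = 0 for every m commuting with x.\<close>

lemma bracket_commuting_nilpotent:
  assumes "x ** bracket x y = bracket x y ** x"
  shows "bracket x y ** bracket x y ** bracket x y = 0"
proof -
  define z where "z = bracket x y"
  have comm: "x ** z = z ** x" using assms by (simp add: z_def)
  have tr: "trace (bracket x y ** m) = 0" if "x ** m = m ** x" for m
  proof -
    have "trace (x ** (y ** m)) = trace ((y ** m) ** x)" by (rule trace_mul_sym)
    also have "\<dots> = trace (y ** (x ** m))" by (simp add: that matrix_mul_assoc[symmetric])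
    finally show ?thesis
      by (simp add: bracket_def matrix_ring_simps trace_sub matrix_mul_assoc)
  qed
  have "trace z = 0" using tr[of "mat 1"] by (simp add: z_def)
  moreover have "trace (z ** z) = 0" using tr[of z] comm by (simp add: z_def)
  moreover have "x ** (z ** z) = (z ** z) ** x"
    using comm by (metis matrix_mul_assoc)
  then have "trace (z ** z ** z) = 0" using tr[of "z ** z"] by (simp add: z_def matrix_mul_assoc)
  ultimately show ?thesis using nilpotent_if_traces_zero unfolding z_def by blast
qed

lemma eigenvalue_exists:
  fixes x :: "complex^3^3"
  obtains l where "det (x - mat l) = 0"
proof -
  define s where "s = x$1$1 * x$2$2 - x$1$2 * x$2$1 + x$1$1 * x$3$3 - x$1$3 * x$3$1 + x$2$2 * x$3$3 - x$2$3 * x$3$2"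
  \<comment> \<open>The characteristic polynomial det(x - l) in \<open>l\<close>, constant
    coefficient first.\<close>
  define p where "p = [:det x, - s, trace x, -1:]"
  have "det (x - mat l) = poly p l" for l
    by (simp add: det_3 mat_def p_def s_def trace_def sum_3 algebra_simps)
  moreover have "\<not> constant (poly p)"
    by (simp add: constant_degree p_def)
  ultimately show ?thesis using fundamental_theorem_of_algebra that by metis
qed

section \<open>The hermitian form of signature (2,1) and its skew operators\<close>

definition herm :: "complex^3 \<Rightarrow> complex^3 \<Rightarrow> complex" where
  "herm u w = cnj (u$1) * w$1 + cnj (u$2) * w$2 - cnj (u$3) * w$3"

lemma E_nth: "E k l $ i $ j = (if i = k \<and> j = l then 1 else 0)"
  by (simp add: E_def)

lemma N_nth: "N $ i $ j = (if i = j then if i = 3 then -1 else 1 else 0)"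
  using exhaust_3[of i] exhaust_3[of j] by (auto simp: N_def E_nth)

lemma N_involution: "N ** N = mat 1"
  by (simp add: vec_eq_iff forall_3 matrix_matrix_mult_def sum_3 N_nth mat_def)

lemma matrix_inv_N: "matrix_inv N = N"
  by (rule matrix_inv_unique) (simp_all add: N_involution)

lemma su21_iff:
  "x \<in> su21 \<longleftrightarrow> x$1$1 + x$2$2 + x$3$3 = 0 \<and>
     cnj (x$1$1) = - x$1$1 \<and> cnj (x$2$2) = - x$2$2 \<and> cnj (x$3$3) = - x$3$3 \<and>
     x$2$1 = - cnj (x$1$2) \<and> x$3$1 = cnj (x$1$3) \<and> x$3$2 = cnj (x$2$3)"
proof -
  define m where "m = - (N ** conj_transpose x ** matrix_inv N)"
  have M: "m$1$1 = - cnj (x$1$1)" "m$1$2 = - cnj (x$2$1)" "m$1$3 = cnj (x$3$1)"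
    "m$2$1 = - cnj (x$1$2)" "m$2$2 = - cnj (x$2$2)" "m$2$3 = cnj (x$3$2)"
    "m$3$1 = cnj (x$1$3)" "m$3$2 = cnj (x$2$3)" "m$3$3 = - cnj (x$3$3)"
    by (simp_all add: m_def matrix_inv_N matrix_matrix_mult_def sum_3 N_nth conj_transpose_def)
  have "m = x \<longleftrightarrow>
     cnj (x$1$1) = - x$1$1 \<and> cnj (x$2$2) = - x$2$2 \<and> cnj (x$3$3) = - x$3$3 \<and>
     x$2$1 = - cnj (x$1$2) \<and> x$3$1 = cnj (x$1$3) \<and> x$3$2 = cnj (x$2$3)" (is "?l \<longleftrightarrow> ?r")
  proof
    have eq: "?l \<longleftrightarrow> (- cnj (x$1$1) = x$1$1 \<and> - cnj (x$2$1) = x$1$2 \<and> cnj (x$3$1) = x$1$3) \<and>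
      (- cnj (x$1$2) = x$2$1 \<and> - cnj (x$2$2) = x$2$2 \<and> cnj (x$3$2) = x$2$3) \<and>
      (cnj (x$1$3) = x$3$1 \<and> cnj (x$2$3) = x$3$2 \<and> - cnj (x$3$3) = x$3$3)"
      unfolding vec_eq_iff[where y=x] vec_eq_iff[where y="x$i" for i] forall_3 M ..
    show "?r" if "?l"
    proof -
      have "- cnj (x$1$1) = x$1$1" "- cnj (x$2$2) = x$2$2" "- cnj (x$3$3) = x$3$3"
        "- cnj (x$1$2) = x$2$1" "cnj (x$1$3) = x$3$1" "cnj (x$2$3) = x$3$2"
        using that eq by blast+
      then show ?thesis by (intro conjI; metis minus_minus)
    qed
    show "?l" if "?r"
      unfolding eq using that
      by (elim conjE) (simp only: complex_cnj_cnj complex_cnj_minus minus_minus simp_thms)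
  qed
  then show ?thesis by (simp add: su21_def trace_def sum_3 m_def)
qed

lemma subspace_su21: "subspace su21"
proof (rule subspaceI)
  fix x y assume "x \<in> su21" "y \<in> su21"
  then have "x$1$1 + x$2$2 + x$3$3 + (y$1$1 + y$2$2 + y$3$3) = 0" by (simp add: su21_iff)
  then have "(x + y)$1$1 + (x + y)$2$2 + (x + y)$3$3 = 0" by (simp add: algebra_simps)
  then show "x + y \<in> su21" using \<open>x \<in> su21\<close> \<open>y \<in> su21\<close> by (simp add: su21_iff)
next
  fix c x assume "x \<in> su21"
  then have "c *\<^sub>R (x$1$1 + x$2$2 + x$3$3) = 0" by (simp add: su21_iff)
  then have "(c *\<^sub>R x)$1$1 + (c *\<^sub>R x)$2$2 + (c *\<^sub>R x)$3$3 = 0"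
    by (simp add: scaleR_add_right)
  then show "c *\<^sub>R x \<in> su21" using \<open>x \<in> su21\<close> by (simp add: su21_iff)
qed (simp add: su21_iff)

text \<open>The infinitesimal form of unitarity. Its main use: an element of \<open>su21\<close>
  that preserves a line also preserves the orthogonal complement.\<close>

lemma herm_su21: "x \<in> su21 \<Longrightarrow> herm (x *v u) w = - herm u (x *v w)"
  by (simp add: su21_iff herm_def matrix_vector_mult_def sum_3 algebra_simps)

lemma herm_zero [simp]: "herm 0 u = 0" "herm u 0 = 0"
  by (simp_all add: herm_def)

lemma norm_squares_zero: "cnj p * p + cnj q * q = 0 \<Longrightarrow> p = 0 \<and> q = 0"
proof -
  assume "cnj p * p + cnj q * q = 0"
  then have "complex_of_real ((cmod p)\<^sup>2 + (cmod q)\<^sup>2) = 0"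
    by (simp only: of_real_add complex_norm_square mult.commute)
  then have "(cmod p)\<^sup>2 + (cmod q)\<^sup>2 = 0" by (simp only: of_real_eq_0_iff)
  then show ?thesis by (simp add: sum_power2_eq_zero_iff)
qed

text \<open>Subtracting \<open>k\<close> times \<open>e\<close> from \<open>f\<close> clears the
  third coordinate and keeps the vector isotropic; on vectors with third coordinate 0 the form is
  positive definite.\<close>

lemma isotropic_parallel:
  assumes "herm e e = 0" "herm e f = 0" "herm f f = 0" "e \<noteq> 0"
  shows "\<exists>c. f = c *s e"
proof -
  have e3: "e$3 \<noteq> 0"
  proof
    assume "e$3 = 0"
    with assms(1) have "e$1 = 0 \<and> e$2 = 0" by (intro norm_squares_zero) (simp add: herm_def)
    with \<open>e$3 = 0\<close> assms(4) show False by (simp add: vec_eq_iff forall_3)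
  qed
  define k where "k = f$3 / e$3"
  have k: "f$3 = k * e$3" using e3 by (simp add: k_def)
  have fe: "herm f e = 0"
  proof -
    have "herm f e = cnj (herm e f)" by (simp add: herm_def algebra_simps)
    then show ?thesis using assms(2) by simp
  qed
  define p where "p = f$1 - k * e$1"
  define q where "q = f$2 - k * e$2"
  have "cnj p * p + cnj q * q = herm f f - k * herm f e - cnj k * herm e f + cnj k * k * herm e e"
    unfolding p_def q_def herm_def k complex_cnj_diff complex_cnj_mult by algebra
  then have "p = 0 \<and> q = 0" using assms fe by (intro norm_squares_zero) simp
  then have "f = k *s e" using k by (simp add: vec_eq_iff forall_3 p_def q_def)
  then show ?thesis by blast
qed

section \<open>A complex line invariant under the algebra\<close>

definition invariant_line :: "cmat3 set \<Rightarrow> complex^3 \<Rightarrow> bool" where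
  "invariant_line v e \<longleftrightarrow> e \<noteq> 0 \<and> (\<forall>y\<in>v. \<exists>c. y *v e = c *s e)"

text \<open>
  The operator t = x - l, for an eigenvalue l of x, commutes with v. Since t is singular and nonzero,
  its kernel or its image is a line.
\<close>

lemma invariant_line_of_central:
  assumes "x \<noteq> 0" "trace x = 0" "\<And>y. y \<in> v \<Longrightarrow> bracket x y = 0"
  shows "\<exists>e. invariant_line v e"
proof -
  obtain l where "det (x - mat l) = 0" by (rule eigenvalue_exists)
  define t where "t = x - mat l"
  have matl: "y ** mat l = mat l ** y" for y :: cmat3
    by (simp add: vec_eq_iff forall_3 matrix_matrix_mult_def sum_3 mat_def)
  have comm: "t *v (y *v u) = y *v (t *v u)" if "y \<in> v" for y u
    using assms(3)[OF that]
    by (simp add: matrix_vector_mul_assoc t_def matrix_ring_simps bracket_def matl)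
  have "t \<noteq> 0"
  proof
    assume "t = 0"
    then have x: "x = mat l" by (simp add: t_def)
    then have "3 * l = 0" using assms(2) by (simp add: trace_def mat_def sum_3)
    then show False using x assms(1) by (simp add: mat_0)
  qed
  obtain e where e: "e \<noteq> 0" "t *v e = 0" using singular_kernel \<open>det (x - mat l) = 0\<close> t_def by blast
  show ?thesis
  proof (cases "invariant_line v e")
    case False
    then obtain y where y: "y \<in> v" "\<nexists>c. y *v e = c *s e" using e by (auto simp: invariant_line_def)
    have "t *v (y *v e) = 0" using comm[OF y(1)] e by simp
    then obtain d where d: "\<And>u. \<exists>k. t *v u = k *s d"
      using range_line_if_kernel_plane[OF e(2) _ e(1) y(2)] by blast
    obtain g where g: "t *v g \<noteq> 0"
      using \<open>t \<noteq> 0\<close> by (metis matrix_eq matrix_vector_mult_0)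
    obtain k where k: "t *v g = k *s d" using d by blast
    with g have "k \<noteq> 0" by auto
    have "\<exists>c. y *v (t *v g) = c *s (t *v g)" if "y \<in> v" for y
    proof -
      obtain m where "t *v (y *v g) = m *s d" using d by blast
      then have "y *v (t *v g) = (m / k) *s (t *v g)"
        using comm[OF that] k \<open>k \<noteq> 0\<close> by (simp add: vector_smult_assoc)
      then show ?thesis by blast
    qed
    then show ?thesis using g by (auto simp: invariant_line_def)
  qed blast
qed

text \<open>
  The invariant line is the image of u^2. The commutation hypothesis gives u y u^2 = 0, so y maps that
  image into the kernel of u, which is the same line.
\<close>

lemma invariant_line_of_regular_nilpotent:
  assumes "u ** u ** u = 0" "u ** u \<noteq> 0" "\<And>y. y \<in> v \<Longrightarrow> u ** bracket u y = bracket u y ** u"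
  shows "\<exists>e. invariant_line v e"
proof -
  have key: "u ** (y ** (u ** u)) = 0" if "y \<in> v" for y
  proof -
    have nil: "u ** (u ** u) = 0" "u ** (u ** (u ** m)) = 0" for m
      using assms(1) by (simp_all add: matrix_mul_assoc matrix_ring_simps)
    \<comment> \<open>Commutation reads u^2 y - 2 u y u + y u^2 = 0. Multiplied by \<open>u\<close>
      on the left and on the right, it gives p = 2q and q = 2p for p = u y u^2 and q = u^2 y u,
      hence p = 4p.\<close>
    have h: "u ** (u ** y) - u ** (y ** u) = u ** (y ** u) - y ** (u ** u)"
      using assms(3)[OF that] by (simp add: bracket_def matrix_ring_simps matrix_mul_assoc)
    have "u ** (u ** (u ** y)) - u ** (u ** (y ** u)) = u ** (u ** (y ** u)) - u ** (y ** (u ** u))"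
      using arg_cong[OF h, of "\<lambda>m. u ** m"] unfolding matrix_diff_ldistrib .
    then have left: "u ** (y ** (u ** u)) = u ** (u ** (y ** u)) + u ** (u ** (y ** u))"
      unfolding nil by (simp add: algebra_simps)
    have "u ** (u ** (y ** u)) - u ** (y ** (u ** u)) = u ** (y ** (u ** u)) - y ** (u ** (u ** u))"
      using arg_cong[OF h, of "\<lambda>m. m ** u"] unfolding matrix_diff_rdistrib matrix_mul_assoc[symmetric] .
    then have right: "u ** (u ** (y ** u)) = u ** (y ** (u ** u)) + u ** (y ** (u ** u))"
      unfolding nil matrix_zero_right by (simp add: algebra_simps)
    have "p = 0" if p: "p = q + q" and q: "q = p + p" for p q :: cmat3
    proof -
      have "p = 4 *\<^sub>R p" using p q by (simp add: scaleR_2[symmetric])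
      then have "(4 - 1) *\<^sub>R p = 0" by (simp only: scaleR_left_diff_distrib scaleR_one) simp
      then show ?thesis by simp
    qed
    from this[OF left right] show ?thesis .
  qed
  obtain w where w: "(u ** u) *v w \<noteq> 0" using assms(2) by (metis matrix_eq matrix_vector_mult_0)
  define e where "e = u *v (u *v w)"
  have e: "e \<noteq> 0" "u *v e = 0"
    using w assms(1) by (simp_all add: e_def matrix_vector_mul_assoc matrix_mul_assoc)
  have "\<exists>c. y *v e = c *s e" if y: "y \<in> v" for y
  proof (rule ccontr)
    assume neg: "\<nexists>c. y *v e = c *s e"
    have "u *v (y *v e) = 0" using key[OF y] by (simp add: e_def matrix_vector_mul_assoc matrix_mul_assoc)
    \<comment> \<open>The kernel of \<open>u\<close> would contain a plane and its image would lie
      in the line C d. Then \<open>e\<close> spans that line and is killed by \<open>u\<close>, so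
      \<open>e\<close>, being u(u w), would be 0.\<close>
    then obtain d where d: "\<And>w. \<exists>k. u *v w = k *s d"
      using range_line_if_kernel_plane[OF e(2) _ e(1) neg] by blast
    obtain k where k: "e = k *s d" using d e_def by blast
    with e have "k \<noteq> 0" "u *v d = 0" by (auto simp: vector_scalar_commute)
    moreover obtain m where "u *v w = m *s d" using d by blast
    ultimately show False using e by (simp add: e_def vector_scalar_commute)
  qed
  then show ?thesis using e by (auto simp: invariant_line_def)
qed

text \<open>An \<open>x\<close> in \<open>a\<close> commuting with \<open>v\<close> gives the line
  at once. Otherwise z = [x, y0] is a nilpotent element of \<open>a\<close>, and the cases are: z^2
  is nonzero; some [y, z] has nonzero square; neither.\<close>

lemma invariant_line_exists:
  assumes v: "lie_subalgebra v su21" and a: "lie_ideal a v" "a \<noteq> {0}"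
    and ab: "\<And>x y. x \<in> a \<Longrightarrow> y \<in> a \<Longrightarrow> bracket x y = 0"
  shows "\<exists>e. invariant_line v e"
proof -
  have a_sub: "a \<subseteq> v" using a by (simp add: lie_ideal_def)
  have a_id: "bracket y x \<in> a" if "x \<in> a" "y \<in> v" for x y
    using a that by (auto simp: lie_ideal_def)
  have v_sub: "v \<subseteq> su21" using v by (simp add: lie_subalgebra_def)
  have comm: "x ** bracket x y = bracket x y ** x" if "x \<in> a" "y \<in> v" for x y
  proof -
    have "bracket x y \<in> a"
      using a_id[OF that] a(1) by (simp add: bracket_skew[of x y] lie_ideal_def subspace_neg)
    then have "bracket x (bracket x y) = 0" using ab that by blast
    then show ?thesis by (simp add: bracket_def)
  qed
  obtain x where x: "x \<in> a" "x \<noteq> 0" using a by (auto simp: lie_ideal_def dest: subspace_0)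
  show ?thesis
  proof (cases "\<forall>y\<in>v. bracket x y = 0")
    case True
    have "trace x = 0" using x a_sub v_sub by (auto simp: su21_def)
    then show ?thesis using invariant_line_of_central x True by blast
  next
    case False
    then obtain y0 where y0: "y0 \<in> v" "bracket x y0 \<noteq> 0" by blast
    define z where "z = bracket x y0"
    have za: "z \<in> a"
      using a_id[OF x(1) y0(1)] a(1) by (simp add: z_def bracket_skew[of x y0] lie_ideal_def subspace_neg)
    have z: "z \<noteq> 0" "z ** z ** z = 0"
      using y0 bracket_commuting_nilpotent[OF comm[OF x(1) y0(1)]] by (simp_all add: z_def)
    show ?thesis
    proof (cases "z ** z = 0")
      case False
      then show ?thesis using invariant_line_of_regular_nilpotent z comm[OF za] by blast
    next
      case sq: True
      have sq': "z ** (z ** m) = 0" for m using sq by (simp add: matrix_mul_assoc matrix_ring_simps)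
      \<comment> \<open>With z^2 = 0 the double bracket [z, [z, y]] equals -2 z y z, and it vanishes
        because \<open>a\<close> is abelian.\<close>
      have zyz: "z ** (y ** z) = 0" if "y \<in> v" for y
      proof -
        have "z ** bracket z y = - (z ** (y ** z))" "bracket z y ** z = z ** (y ** z)"
          by (simp_all add: bracket_def matrix_ring_simps sq sq' matrix_mul_assoc[symmetric])
        then have "2 *\<^sub>R (z ** (y ** z)) = 0"
          using comm[OF za that] by (metis scaleR_2 add.left_inverse)
        then show ?thesis by simp
      qed
      have zyz': "z ** (y ** (z ** m)) = 0" if "y \<in> v" for y m
        using zyz[OF that] by (metis matrix_mul_assoc matrix_zero_left)
      show ?thesis
      proof (cases "\<exists>y\<in>v. z ** (y ** (y ** z)) \<noteq> 0")
        case True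
        then obtain y where y: "y \<in> v" "z ** (y ** (y ** z)) \<noteq> 0" by blast
        \<comment> \<open>By z^2 = 0 and z y z = 0, only the term -z y y z of (y z - z y)^2
          survives, and a further factor \<open>u\<close> kills it.\<close>
        define u where "u = bracket y z"
        have ua: "u \<in> a" using a_id[OF za y(1)] by (simp add: u_def)
        have uu: "u ** u = - (z ** (y ** (y ** z)))"
          by (simp add: u_def bracket_def matrix_ring_simps matrix_mul_assoc[symmetric]
              sq sq' zyz[OF y(1)] zyz'[OF y(1)])
        have "u ** u ** u = 0"
          unfolding uu
          by (simp add: u_def bracket_def matrix_ring_simps matrix_mul_assoc[symmetric]
              sq sq' zyz[OF y(1)] zyz'[OF y(1)])
        moreover have "u ** u \<noteq> 0" using uu y by simp
        ultimately show ?thesis using invariant_line_of_regular_nilpotent comm[OF ua] by blast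
      next
        case False
        \<comment> \<open>For e in the image of z, the vectors e and y e span an isotropic subspace, hence a line.\<close>
        obtain w where w: "z *v w \<noteq> 0" using z by (metis matrix_eq matrix_vector_mult_0)
        define e where "e = z *v w"
        have zs: "z \<in> su21" using za a_sub v_sub by auto
        have "\<exists>c. y *v e = c *s e" if y: "y \<in> v" for y
        proof (rule isotropic_parallel)
          have ys: "y \<in> su21" using y v_sub by auto
          show "herm e e = 0"
            by (simp add: e_def herm_su21[OF zs] matrix_vector_mul_assoc sq)
          show "herm e (y *v e) = 0"
            using zyz[OF y] by (simp add: e_def herm_su21[OF zs] matrix_vector_mul_assoc matrix_mul_assoc)
          \<comment> \<open>Skewness moves \<open>y\<close> and then \<open>z\<close> to the right,
            leaving the pairing of \<open>w\<close> with z y y z w, which is 0 in this case.\<close>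
          show "herm (y *v e) (y *v e) = 0"
            using False y unfolding e_def herm_su21[OF ys] herm_su21[OF zs]
            by (simp add: matrix_vector_mul_assoc matrix_mul_assoc)
          show "e \<noteq> 0" using w by (simp add: e_def)
        qed
        then show ?thesis using w by (auto simp: invariant_line_def e_def)
      qed
    qed
  qed
qed

section \<open>An isotropic invariant line forces solvability\<close>

lemma scaleR_eq_smult: "c *\<^sub>R u = of_real c *s u" for u :: "complex^'n"
  by (simp only: vec_eq_iff vector_scaleR_component vector_smult_component) (simp add: scaleR_conv_of_real)

lemma scaleR_matrix_mult_vector: "(c *\<^sub>R x) *v u = c *\<^sub>R (x *v u)" for x :: "'a::real_algebra_1^'n^'m"
  by (vector matrix_vector_mult_def scaleR_sum_right)

lemma subspace_line: "subspace (range (\<lambda>k. k *s (e :: complex^'n)))"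
proof (rule subspaceI)
  show "0 \<in> range (\<lambda>k. k *s e)" by (rule range_eqI[of _ _ 0]) simp
next
  fix x y assume "x \<in> range (\<lambda>k. k *s e)" "y \<in> range (\<lambda>k. k *s e)"
  then show "x + y \<in> range (\<lambda>k. k *s e)" by (auto simp flip: vector_sadd_rdistrib)
next
  fix c x assume "x \<in> range (\<lambda>k. k *s e)"
  then show "c *\<^sub>R x \<in> range (\<lambda>k. k *s e)" by (auto simp: scaleR_eq_smult)
qed

lemma subspace_vimage_mult_vector:
  assumes "subspace (w :: (complex^'n) set)"
  shows "subspace {x :: complex^'n^'n. x *v u \<in> w}"
  using assms
  by (auto intro!: subspaceI simp: matrix_vector_mult_add_rdistrib subspace_add subspace_0
      subspace_scale scaleR_matrix_mult_vector)

lemma herm_smult: "herm (c *s u) w = cnj c * herm u w" "herm u (c *s w) = c * herm u w"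
  by (simp_all add: herm_def algebra_simps)

text \<open>Subtracting \<open>a\<close> times \<open>e\<close> clears the third coordinate of
  \<open>u\<close>; what remains is orthogonal to (e1, e2) in C^2, hence a multiple of
  \<open>f\<close>.\<close>

lemma isotropic_orthogonal_complement:
  assumes "herm e e = 0" "e \<noteq> 0"
  obtains f where "herm e f = 0" "\<And>u. herm e u = 0 \<Longrightarrow> \<exists>a b. u = a *s e + b *s f"
proof
  define f :: "complex^3" where "f = vector [- cnj (e$2), cnj (e$1), 0]"
  have f: "f$1 = - cnj (e$2)" "f$2 = cnj (e$1)" "f$3 = 0" by (simp_all add: f_def vector_3)
  show "herm e f = 0" by (simp add: herm_def f)
  fix u assume u: "herm e u = 0"
  have r: "cnj (e$1) * e$1 + cnj (e$2) * e$2 = cnj (e$3) * e$3" using assms(1) by (simp add: herm_def)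
  have e3: "e$3 \<noteq> 0"
  proof
    assume "e$3 = 0"
    with r have "e$1 = 0 \<and> e$2 = 0" by (intro norm_squares_zero) simp
    with \<open>e$3 = 0\<close> assms(2) show False by (simp add: vec_eq_iff forall_3)
  qed
  define a where "a = u$3 / e$3"
  define p where "p = u$1 - a * e$1"
  define q where "q = u$2 - a * e$2"
  define s where "s = cnj (e$3) * e$3"
  have a: "u$3 = a * e$3" using e3 by (simp add: a_def)
  have s: "s \<noteq> 0" "cnj (e$1) * e$1 + cnj (e$2) * e$2 = s" using e3 r by (simp_all add: s_def)
  have pq: "cnj (e$1) * p + cnj (e$2) * q = 0"
    using u r a unfolding herm_def p_def q_def by algebra
  \<comment> \<open>Solves (p, q) = b (f1, f2) by pairing both sides with (-e2, e1); isotropy makes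
    the divisor |e1|^2 + |e2|^2 equal to |e3|^2.\<close>
  define b where "b = (e$1 * q - e$2 * p) / s"
  have b: "b * s = e$1 * q - e$2 * p" using s by (simp add: b_def)
  have "(b * f$1 - p) * s = 0" "(b * f$2 - q) * s = 0"
    using b pq s(2) unfolding f by algebra+
  then have "p = b * f$1" "q = b * f$2" using s by simp_all
  then have "u = a *s e + b *s f"
    by (simp add: vec_eq_iff forall_3 a p_def q_def f) (simp add: algebra_simps)
  then show "\<exists>a b. u = a *s e + b *s f" by blast
qed

text \<open>
  In the flag formed by C e, its orthogonal complement and the whole space, the sets S1 and S2 below
  contain the first and the second derived algebra.
\<close>

lemma solvable_if_isotropic_line:
  assumes v: "lie_subalgebra v su21" and e: "invariant_line v e" "herm e e = 0"
  shows "lie_solvable v"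
proof -
  have e0: "e \<noteq> 0" and ve: "\<And>y. y \<in> v \<Longrightarrow> \<exists>c. y *v e = c *s e"
    using e by (auto simp: invariant_line_def)
  have sub: "v \<subseteq> su21" "subspace v" and br: "\<And>x y. x \<in> v \<Longrightarrow> y \<in> v \<Longrightarrow> bracket x y \<in> v"
    using v by (auto simp: lie_subalgebra_def)
  obtain f where f: "herm e f = 0" "\<And>u. herm e u = 0 \<Longrightarrow> \<exists>a b. u = a *s e + b *s f"
    using isotropic_orthogonal_complement[OF e(2) e0] by blast
  let ?L = "range (\<lambda>k. k *s e)"
  define S1 where "S1 = su21 \<inter> {x. x *v e \<in> {0}} \<inter> {x. x *v f \<in> ?L}"
  define S2 where "S2 = {x. x *v e \<in> {0}} \<inter> {x. x *v f \<in> {0}} \<inter> (\<Inter>u. {x. x *v u \<in> ?L})"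
  have lin: "x *v (a *s e + b *s f) = a *s (x *v e) + b *s (x *v f)" for x :: cmat3 and a b
    by (simp add: matrix_vector_right_distrib vector_scalar_commute)
  have "derived_algebra v \<subseteq> S1"
  proof (rule derived_algebra_subset)
    show "subspace S1" unfolding S1_def
      by (intro subspace_inter subspace_su21 subspace_vimage_mult_vector subspace_line subspace_single_0)
  next
    fix x y assume x: "x \<in> v" and y: "y \<in> v"
    obtain c where c: "x *v e = c *s e" using ve x by blast
    obtain d where d: "y *v e = d *s e" using ve y by blast
    have xf: "\<exists>a b. x *v f = a *s e + b *s f" if "x \<in> v" for x
    proof (rule f(2))
      obtain c where c: "x *v e = c *s e" using ve \<open>x \<in> v\<close> by blast
      have "herm (x *v e) f = - herm e (x *v f)" using that sub by (intro herm_su21) auto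
      then show "herm e (x *v f) = 0" using f(1) by (simp add: c herm_smult)
    qed
    obtain a b where xf': "x *v f = a *s e + b *s f" using xf x by blast
    obtain a' b' where yf': "y *v f = a' *s e + b' *s f" using xf y by blast
    have "bracket x y *v e = 0"
      by (simp add: bracket_mult_vector c d vector_scalar_commute vector_smult_assoc mult.commute)
    \<comment> \<open>Both operators are upper triangular in \<open>e\<close>, \<open>f\<close>, so
      the diagonal products b b' and b' b cancel and no \<open>f\<close> term is left.\<close>
    moreover have "bracket x y *v f = (a' * c + b' * a - a * d - b * a') *s e"
      unfolding bracket_mult_vector xf' yf' lin c d by (simp add: vec_eq_iff algebra_simps)
    then have "bracket x y *v f \<in> ?L" by blast
    ultimately show "bracket x y \<in> S1" using br[OF x y] sub by (auto simp: S1_def)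
  qed
  moreover have "derived_algebra S1 \<subseteq> S2"
  proof (rule derived_algebra_subset)
    show "subspace S2" unfolding S2_def
      by (intro subspace_inter subspace_Int subspace_vimage_mult_vector subspace_line subspace_single_0)
  next
    fix x y assume x: "x \<in> S1" and y: "y \<in> S1"
    have S1e: "x *v (a *s e) = 0" if "x \<in> S1" for x a
      using that by (simp add: S1_def vector_scalar_commute)
    have S1f: "\<exists>k. x *v f = k *s e" if "x \<in> S1" for x
      using that by (auto simp: S1_def)
    \<comment> \<open>Since \<open>y\<close> is skew and kills \<open>e\<close>, its image lies in
      the orthogonal complement of \<open>e\<close>, which \<open>x\<close> sends into C e. This is
      why \<open>S1\<close> retains membership in \<open>su21\<close>.\<close>
    have img: "x *v (y *v u) \<in> ?L" if x: "x \<in> S1" and y: "y \<in> S1" for x y u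
    proof -
      have "herm (y *v e) u = - herm e (y *v u)" using y by (intro herm_su21) (simp add: S1_def)
      then have "herm e (y *v u) = 0" using S1e[OF y, of 1] by simp
      then obtain a b where "y *v u = a *s e + b *s f" using f(2) by blast
      moreover obtain k where "x *v f = k *s e" using S1f[OF x] by blast
      ultimately have "x *v (y *v u) = (b * k) *s e"
        using S1e[OF x, of 1] by (simp add: lin vector_smult_assoc)
      then show ?thesis by blast
    qed
    obtain k where "x *v f = k *s e" using S1f x by blast
    moreover obtain m where "y *v f = m *s e" using S1f y by blast
    ultimately have "bracket x y *v f = 0" by (simp add: bracket_mult_vector S1e x y)
    moreover have "bracket x y *v e = 0"
      using S1e[OF x, of 1] S1e[OF y, of 1] by (simp add: bracket_mult_vector)
    moreover have "bracket x y *v u \<in> ?L" for u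
      unfolding bracket_mult_vector using x y by (intro subspace_diff subspace_line img)
    ultimately show "bracket x y \<in> S2" by (simp add: S2_def)
  qed
  moreover have "derived_algebra S2 \<subseteq> {0}"
  proof (rule derived_algebra_subset)
    fix x y assume x: "x \<in> S2" and y: "y \<in> S2"
    have z: "x *v (y *v u) = 0" if x: "x \<in> S2" and y: "y \<in> S2" for x y u
    proof -
      obtain k where "y *v u = k *s e" using y by (auto simp: S2_def)
      then show ?thesis using x by (simp add: S2_def vector_scalar_commute)
    qed
    have "bracket x y *v u = 0" for u
      by (simp add: bracket_mult_vector z x y)
    then show "bracket x y \<in> {0}" by (simp add: matrix_eq)
  qed simp
  ultimately have "(derived_algebra ^^ Suc (Suc (Suc 0))) v \<subseteq> {0}"
    by (simp) (meson derived_algebra_mono subset_trans)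
  then show ?thesis using lie_solvable_if_derived subspace_0[OF sub(2)] by blast
qed

section \<open>Moving a nonisotropic line to a coordinate axis by SU(2,1)\<close>

lemma conj_transpose_mult: "conj_transpose (A ** B) = conj_transpose B ** conj_transpose A"
  by (simp add: conj_transpose_def vec_eq_iff matrix_matrix_mult_def mult.commute)

lemma conj_transpose_conj_transpose [simp]: "conj_transpose (conj_transpose A) = A"
  by (simp add: conj_transpose_def vec_eq_iff)

lemma conj_transpose_N [simp]: "conj_transpose N = N"
  by (simp add: conj_transpose_def vec_eq_iff N_nth)

lemma N_cancel: "N ** (N ** A) = A"
  by (simp add: matrix_mul_assoc N_involution)

lemma su21_iff_skew: "x \<in> su21 \<longleftrightarrow> trace x = 0 \<and> conj_transpose x ** N = - (N ** x)"
proof -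
  have "- (N ** (conj_transpose x ** N)) = x \<longleftrightarrow> conj_transpose x ** N = - (N ** x)"
    by (metis N_cancel matrix_minus_right minus_minus)
  then show ?thesis by (simp add: su21_def matrix_inv_N matrix_mul_assoc)
qed

text \<open>\<open>G\<close> preserves the form, so N G* N is its inverse. The inverse
  \<open>g\<close> is the one to act with: \<open>G\<close> will carry a basis vector to a given
  \<open>e\<close>, and conjugation has to lead back.\<close>

lemma SU21_of_unitary:
  assumes G: "conj_transpose G ** N ** G = N" "det G = 1"
  defines "g \<equiv> N ** conj_transpose G ** N"
  shows "g \<in> SU21" "matrix_inv g = G" "g ** G = mat 1" "G ** g = mat 1"
    "x \<in> su21 \<Longrightarrow> g ** x ** G \<in> su21"
proof -
  show gG: "g ** G = mat 1"
    using G(1) by (simp add: g_def matrix_mul_assoc[symmetric] N_involution)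
  show Gg: "G ** g = mat 1" using gG by (simp add: matrix_left_right_inverse)
  show "matrix_inv g = G" using gG Gg by (rule matrix_inv_unique)
  have "det g * det G = 1" using gG by (metis det_mul det_I)
  then have det: "det g = 1" using G(2) by simp
  have ct: "conj_transpose g = N ** G ** N"
    by (simp add: g_def conj_transpose_mult matrix_mul_assoc)
  have "matrix_inv (conj_transpose g) = N ** g ** N"
  proof (rule matrix_inv_unique)
    have cancel: "G ** (g ** A) = A" "g ** (G ** A) = A" for A
      by (simp_all add: matrix_mul_assoc gG Gg)
    show "conj_transpose g ** (N ** g ** N) = mat 1" "N ** g ** N ** conj_transpose g = mat 1"
      by (simp_all add: ct matrix_mul_assoc[symmetric] N_cancel cancel N_involution)
  qed
  then show "g \<in> SU21"
    using det by (simp add: SU21_def matrix_inv_N matrix_mul_assoc[symmetric] N_cancel N_involution)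
  show "g ** x ** G \<in> su21" if x: "x \<in> su21"
  proof -
    have "trace (g ** x ** G) = trace (G ** (g ** x))" by (rule trace_mul_sym)
    then have tr: "trace (g ** x ** G) = 0" using x by (simp add: matrix_mul_assoc Gg su21_iff_skew)
    have "conj_transpose (g ** x ** G) ** N = conj_transpose G ** (conj_transpose x ** (N ** (G ** (N ** N))))"
      by (simp add: conj_transpose_mult ct matrix_mul_assoc)
    also have "\<dots> = conj_transpose G ** ((conj_transpose x ** N) ** G)"
      by (simp add: N_involution matrix_mul_assoc)
    also have "\<dots> = - (conj_transpose G ** (N ** (x ** G)))"
      using x by (simp add: su21_iff_skew matrix_ring_simps matrix_mul_assoc)
    also have "\<dots> = - (N ** (g ** x ** G))"
      by (simp add: g_def matrix_mul_assoc[symmetric] N_cancel)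
    finally show ?thesis using tr by (simp add: su21_iff_skew)
  qed
qed

lemma unitary_completion_positive:
  assumes e: "herm e e = 1"
  obtains G where "conj_transpose G ** N ** G = N" "det G = 1" "G *v axis 2 1 = e"
proof -
  \<comment> \<open>Before division by \<open>r\<close>, the two columns that join \<open>e\<close>
    have form values r^2 and -r^2, where r^2 = |e1|^2 + |e2|^2 = 1 + |e3|^2.\<close>
  define r :: complex where "r = of_real (sqrt ((cmod (e$1))\<^sup>2 + (cmod (e$2))\<^sup>2))"
  define s where "s = inverse r"
  have rr: "r * r = e$1 * cnj (e$1) + e$2 * cnj (e$2)"
    by (simp add: r_def complex_norm_square[symmetric] power2_eq_square[symmetric] flip: of_real_power of_real_add)
  have ee: "e$1 * cnj (e$1) + e$2 * cnj (e$2) - e$3 * cnj (e$3) = 1"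
    using e by (simp add: herm_def mult.commute)
  have "r \<noteq> 0"
  proof
    assume "r = 0"
    then have "cnj (e$1) * e$1 + cnj (e$2) * e$2 = 0" using rr by (simp add: mult.commute)
    then have "e$1 = 0 \<and> e$2 = 0" by (rule norm_squares_zero)
    then have "(- 1) * complex_of_real ((cmod (e$3))\<^sup>2) = 1"
      using ee unfolding complex_norm_square by simp
    then have "complex_of_real (- ((cmod (e$3))\<^sup>2)) = of_real 1" by simp
    then have "- ((cmod (e$3))\<^sup>2) = 1" by (simp only: of_real_eq_iff)
    then show False by (smt (verit) zero_le_power2)
  qed
  then have sr: "s * r = 1" by (simp add: s_def)
  have real: "cnj r = r" "cnj s = s" by (simp_all add: r_def s_def)
  \<comment> \<open>Second column e; the first is orthogonal to e with third entry 0, the third completes both.\<close>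
  define G :: cmat3 where "G = vector [
    vector [cnj (e$2) * s, e$1, cnj (e$3) * e$1 * s],
    vector [- cnj (e$1) * s, e$2, cnj (e$3) * e$2 * s],
    vector [0, e$3, r]]"
  have G: "G$1$1 = cnj (e$2) * s" "G$1$2 = e$1" "G$1$3 = cnj (e$3) * e$1 * s"
    "G$2$1 = - cnj (e$1) * s" "G$2$2 = e$2" "G$2$3 = cnj (e$3) * e$2 * s"
    "G$3$1 = 0" "G$3$2 = e$3" "G$3$3 = r"
    by (simp_all add: G_def vector_3)
  have entry: "(conj_transpose G ** N ** G)$i$j = cnj (G$1$i) * G$1$j + cnj (G$2$i) * G$2$j - cnj (G$3$i) * G$3$j" for i j
    by (simp add: matrix_matrix_mult_def sum_3 N_nth conj_transpose_def)
  have "conj_transpose G ** N ** G = N"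
    unfolding vec_eq_iff forall_3 entry G N_nth complex_cnj_mult complex_cnj_minus complex_cnj_cnj real
    using rr ee sr by (simp, intro conjI; algebra)
  moreover have "det G = 1"
    unfolding det_3 G using rr ee sr by algebra
  moreover have "G *v axis 2 1 = e"
    by (simp add: matrix_vector_mult_def sum_3 axis_def vec_eq_iff forall_3 G)
  ultimately show ?thesis using that by blast
qed

lemma unitary_completion_negative:
  assumes e: "herm e e = -1"
  obtains G where "conj_transpose G ** N ** G = N" "det G = 1" "G *v axis 3 1 = e"
proof -
  define r :: complex where "r = of_real (sqrt (1 + (cmod (e$2))\<^sup>2))"
  define s where "s = inverse r"
  have "0 \<le> 1 + (cmod (e$2))\<^sup>2" by simp
  then have "r * r = of_real (1 + (cmod (e$2))\<^sup>2)"
    by (simp only: r_def of_real_mult[symmetric] real_sqrt_mult_self abs_of_nonneg)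
  then have rr: "r * r = 1 + e$2 * cnj (e$2)"
    unfolding of_real_add complex_norm_square by simp
  have ee: "e$1 * cnj (e$1) + e$2 * cnj (e$2) - e$3 * cnj (e$3) = -1"
    using e by (simp add: herm_def mult.commute)
  have "1 + (cmod (e$2))\<^sup>2 > 0" by (smt (verit) zero_le_power2)
  then have "r \<noteq> 0" by (simp add: r_def)
  then have sr: "s * r = 1" by (simp add: s_def)
  have real: "cnj r = r" "cnj s = s" by (simp_all add: r_def s_def)
  \<comment> \<open>Third column \<open>e\<close>; the first is orthogonal to it with second entry
    0, the second completes both. Here r^2 = 1 + |e2|^2 = |e3|^2 - |e1|^2.\<close>
  define G :: cmat3 where "G = vector [
    vector [cnj (e$3) * s, cnj (e$2) * e$1 * s, e$1],
    vector [0, r, e$2],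
    vector [cnj (e$1) * s, cnj (e$2) * e$3 * s, e$3]]"
  have G: "G$1$1 = cnj (e$3) * s" "G$1$2 = cnj (e$2) * e$1 * s" "G$1$3 = e$1"
    "G$2$1 = 0" "G$2$2 = r" "G$2$3 = e$2"
    "G$3$1 = cnj (e$1) * s" "G$3$2 = cnj (e$2) * e$3 * s" "G$3$3 = e$3"
    by (simp_all add: G_def vector_3)
  have entry: "(conj_transpose G ** N ** G)$i$j = cnj (G$1$i) * G$1$j + cnj (G$2$i) * G$2$j - cnj (G$3$i) * G$3$j" for i j
    by (simp add: matrix_matrix_mult_def sum_3 N_nth conj_transpose_def)
  have "conj_transpose G ** N ** G = N"
    unfolding vec_eq_iff forall_3 entry G N_nth complex_cnj_mult complex_cnj_minus complex_cnj_cnj real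
    using rr ee sr by (simp, intro conjI; algebra)
  moreover have "det G = 1"
    unfolding det_3 G using rr ee sr by algebra
  moreover have "G *v axis 3 1 = e"
    by (simp add: matrix_vector_mult_def sum_3 axis_def vec_eq_iff forall_3 G)
  ultimately show ?thesis using that by blast
qed

lemma herm_self_real: "herm e e \<in> \<real>"
  unfolding herm_def complex_norm_square[symmetric] mult.commute[of "cnj _"] by simp

lemma invariant_line_smult:
  assumes "invariant_line v e" "k \<noteq> 0"
  shows "invariant_line v (k *s e)"
proof -
  have "\<exists>c. y *v (k *s e) = c *s (k *s e)" if y: "y \<in> v" for y
  proof -
    obtain c where "y *v e = c *s e" using assms y by (auto simp: invariant_line_def)
    then have "y *v (k *s e) = c *s (k *s e)"
      by (simp add: vector_scalar_commute vector_smult_assoc mult.commute)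
    then show ?thesis by blast
  qed
  then show ?thesis using assms by (simp add: invariant_line_def)
qed

text \<open>After rescaling, \<open>e\<close> has form value 1 or -1 and is completed as second or
  third column accordingly; these two axes are the lines fixed by \<open>v43\<close> and
  \<open>v44\<close>.\<close>

lemma conjugate_to_axis:
  assumes v: "v \<subseteq> su21" and e: "invariant_line v e" "herm e e \<noteq> 0"
  obtains g k where "g \<in> SU21" "k = 2 \<or> k = 3" "act g v \<subseteq> su21" "invariant_line (act g v) (axis k 1)"
proof -
  obtain h where h: "herm e e = of_real h" using herm_self_real[of e] by (auto elim: Reals_cases)
  define t where "t = 1 / sqrt \<bar>h\<bar>"
  define e' where "e' = of_real t *s e"
  have h0: "h \<noteq> 0" using h e by auto
  then have t: "t \<noteq> 0" "t * t * \<bar>h\<bar> = 1"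
    by (simp_all add: t_def)
  have "herm e' e' = of_real (t * t * h)" by (simp add: e'_def herm_smult h)
  moreover have "t * t * h = 1 \<or> t * t * h = -1" using t(2) by (cases "h \<ge> 0") auto
  ultimately have "herm e' e' = 1 \<or> herm e' e' = -1"
    by (metis of_real_1 of_real_minus)
  then obtain G k where G: "conj_transpose G ** N ** G = N" "det G = 1" "G *v axis k 1 = e'"
    and k: "k = 2 \<or> k = 3"
    by (metis unitary_completion_positive unitary_completion_negative)
  have e': "invariant_line v e'" unfolding e'_def using e t by (intro invariant_line_smult) auto
  define g where "g = N ** conj_transpose G ** N"
  note g = SU21_of_unitary[OF G(1,2), folded g_def]
  have act: "act g v = (\<lambda>x. g ** x ** G) ` v" by (simp add: act_def g)
  have ge: "g *v e' = axis k 1"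
    by (simp add: G(3)[symmetric] matrix_vector_mul_assoc g)
  have "\<exists>c. (g ** x ** G) *v axis k 1 = c *s axis k 1" if x: "x \<in> v" for x
  proof -
    obtain c where c: "x *v e' = c *s e'" using e' x by (auto simp: invariant_line_def)
    have "(g ** x ** G) *v axis k 1 = g *v (x *v e')"
      by (simp add: G(3)[symmetric] matrix_vector_mul_assoc matrix_mul_assoc)
    also have "\<dots> = c *s axis k 1" by (simp add: c vector_scalar_commute ge)
    finally show ?thesis by blast
  qed
  then have "invariant_line (act g v) (axis k 1)"
    by (auto simp: act invariant_line_def axis_eq_0_iff)
  moreover have "act g v \<subseteq> su21" using v g(5) by (auto simp: act)
  ultimately show ?thesis using that g k by metis
qed

section \<open>Four-dimensional algebras with one-dimensional centre\<close>

text \<open>A three-dimensional simple real Lie algebra has a basis with cyclic brackets and nonzero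
  constants. Their signs alone separate su(2) (all equal) from su(1,1) (mixed), so one argument
  serves both stabilisers.\<close>

locale one_dim_center =
  fixes Z X1 X2 X3 :: cmat3 and c1 c2 c3 :: real
  assumes c_nz: "c1 \<noteq> 0" "c2 \<noteq> 0" "c3 \<noteq> 0"
    and bracket_Z: "bracket Z X1 = 0" "bracket Z X2 = 0" "bracket Z X3 = 0"
    and bracket_X: "bracket X1 X2 = c3 *\<^sub>R X3" "bracket X2 X3 = c1 *\<^sub>R X1" "bracket X3 X1 = c2 *\<^sub>R X2"
    and indep: "a *\<^sub>R Z + b *\<^sub>R X1 + c *\<^sub>R X2 + d *\<^sub>R X3 = 0 \<Longrightarrow> a = 0 \<and> b = 0 \<and> c = 0 \<and> d = 0"
begin

text \<open>
  In the coordinates of comb the bracket is the cross product of the second components, rescaled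
  by sc; the first component is the centre.
\<close>

definition comb :: "real \<Rightarrow> real^3 \<Rightarrow> cmat3" where
  "comb a q = a *\<^sub>R Z + q$1 *\<^sub>R X1 + q$2 *\<^sub>R X2 + q$3 *\<^sub>R X3"

definition sc :: "real^3 \<Rightarrow> real^3" where
  "sc q = vector [c1 * q$1, c2 * q$2, c3 * q$3]"

lemma comb_add: "comb a p + comb b q = comb (a + b) (p + q)"
  by (simp add: comb_def algebra_simps)

lemma comb_scale: "k *\<^sub>R comb a p = comb (k * a) (k *\<^sub>R p)"
  by (simp add: comb_def algebra_simps)

lemma comb_zero [simp]: "comb 0 0 = 0"
  by (simp add: comb_def)

lemma comb_eq_0_iff: "comb a q = 0 \<longleftrightarrow> a = 0 \<and> q = 0"
  using indep[of a "q$1" "q$2" "q$3"] by (auto simp: comb_def vec_eq_iff forall_3)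

lemma comb_generators: "comb 1 0 = Z" "comb 0 (axis 1 1) = X1" "comb 0 (axis 2 1) = X2" "comb 0 (axis 3 1) = X3"
  by (simp_all add: comb_def axis_def)

lemma sc_scale: "sc (k *\<^sub>R q) = k *\<^sub>R sc q"
  by (simp add: sc_def vec_eq_iff forall_3 vector_3)

lemma sc_zero: "sc 0 = 0"
  by (simp add: sc_def vec_eq_iff forall_3 vector_3)

lemma linear_comb: "linear (\<lambda>p. comb (fst p) (snd p))"
  by (rule linearI) (simp_all add: comb_add comb_scale)

lemma span_eq: "span {Z, X1, X2, X3} = (\<lambda>p. comb (fst p) (snd p)) ` UNIV"
proof
  have "{Z, X1, X2, X3} \<subseteq> (\<lambda>p. comb (fst p) (snd p)) ` UNIV"
  proof -
    have "comb a q \<in> (\<lambda>p. comb (fst p) (snd p)) ` UNIV" for a q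
      by (rule image_eqI[of _ _ "(a, q)"]) simp_all
    from this[of 1 0] this[of 0 "axis 1 1"] this[of 0 "axis 2 1"] this[of 0 "axis 3 1"]
    show ?thesis unfolding comb_generators by blast
  qed
  then show "span {Z, X1, X2, X3} \<subseteq> (\<lambda>p. comb (fst p) (snd p)) ` UNIV"
    by (rule span_minimal) (rule linear_subspace_image[OF linear_comb subspace_UNIV])
  show "(\<lambda>p. comb (fst p) (snd p)) ` UNIV \<subseteq> span {Z, X1, X2, X3}"
    by (auto simp: comb_def intro!: span_add span_scale intro: span_base)
qed

lemma in_span_iff: "x \<in> span {Z, X1, X2, X3} \<longleftrightarrow> (\<exists>a q. x = comb a q)"
  unfolding span_eq image_iff by simp

lemma dim_span: "dim (span {Z, X1, X2, X3}) = 4"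
proof -
  have "inj (\<lambda>p. comb (fst p) (snd p))"
    unfolding linear_injective_0[OF linear_comb] by (auto simp: comb_eq_0_iff prod_eq_iff)
  then have "dim ((\<lambda>p. comb (fst p) (snd p)) ` UNIV) = dim (UNIV :: (real \<times> (real^3)) set)"
    by (intro dim_image_eq[OF linear_comb]) (simp only: span_UNIV)
  then show ?thesis unfolding span_eq by simp
qed

lemma bracket_comb: "bracket (comb a p) (comb b q) = comb 0 (sc (cross3 p q))"
proof -
  note rules = bilinear_ladd[OF bilinear_bracket] bilinear_radd[OF bilinear_bracket]
    bilinear_lmul[OF bilinear_bracket] bilinear_rmul[OF bilinear_bracket]
  have "bracket X2 X1 = - (c3 *\<^sub>R X3)" "bracket X3 X2 = - (c1 *\<^sub>R X1)" "bracket X1 X3 = - (c2 *\<^sub>R X2)"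
    "bracket X1 Z = 0" "bracket X2 Z = 0" "bracket X3 Z = 0"
    using bracket_skew bracket_X bracket_Z by (metis neg_equal_0_iff_equal)+
  then show ?thesis
    by (simp add: comb_def rules bracket_X bracket_Z sc_def cross3_def vector_3 algebra_simps)
qed

lemma bracket_in_span:
  "x \<in> span {Z, X1, X2, X3} \<Longrightarrow> y \<in> span {Z, X1, X2, X3} \<Longrightarrow> bracket x y \<in> span {Z, X1, X2, X3}"
  by (metis in_span_iff bracket_comb)

lemma subspace_snd: "subspace v \<Longrightarrow> subspace {q. \<exists>a. comb a q \<in> v}"
  by (rule subspaceI)
    (auto intro: exI[of _ 0] simp: subspace_0, metis comb_add subspace_add, metis comb_scale subspace_scale)

text \<open>
  If the projection of v modulo the centre is contained in a plane with normal n, then all brackets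
  are multiples of the image of n.
\<close>

lemma projection_surj_if_not_solvable:
  assumes "subspace v" "v \<subseteq> span {Z, X1, X2, X3}" "\<not> lie_solvable v"
  shows "\<exists>a. comb a q \<in> v"
proof (rule ccontr)
  assume neg: "\<nexists>a. comb a q \<in> v"
  define Q where "Q = {q. \<exists>a. comb a q \<in> v}"
  have Q: "subspace Q" unfolding Q_def using assms(1) by (rule subspace_snd)
  have "Q \<noteq> UNIV" using neg by (auto simp: Q_def)
  then have "dim Q < DIM(real^3)"
    using dim_eq_full[of Q] Q dim_subset_UNIV[of Q] by (metis span_eq_iff le_neq_implies_less)
  then obtain n where n: "n \<noteq> 0" "\<And>q. q \<in> span Q \<Longrightarrow> orthogonal n q"
    using orthogonal_to_subspace_exists by blast
  have cr: "\<exists>k. cross3 p q = k *\<^sub>R n" if "p \<in> Q" "q \<in> Q" for p q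
  proof -
    have "inner n p = 0" "inner n q = 0"
      using n(2) that by (auto simp: orthogonal_def span_base)
    \<comment> \<open>By n x (p x q) = (n.q) p - (n.p) q; hence p x q is parallel to the normal
      \<open>n\<close>.\<close>
    then have "cross3 n (cross3 p q) = 0" by (simp add: Lagrange)
    then have "collinear {0, n, cross3 p q}" by (simp add: cross_eq_0)
    then show ?thesis using n(1) by (auto simp: collinear_lemma intro: exI[of _ 0])
  qed
  define m where "m = comb 0 (sc n)"
  have "derived_algebra v \<subseteq> span {m}"
  proof (rule derived_algebra_subset)
    fix x y assume xy: "x \<in> v" "y \<in> v"
    then obtain a p b q where pq: "x = comb a p" "y = comb b q"
      using assms(2) in_span_iff by blast
    then have "p \<in> Q" "q \<in> Q" using xy by (auto simp: Q_def)
    then obtain k where "cross3 p q = k *\<^sub>R n" using cr by blast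
    then have "bracket x y = k *\<^sub>R m"
      by (simp add: pq bracket_comb m_def comb_scale sc_scale)
    then show "bracket x y \<in> span {m}" by (simp add: span_base span_scale)
  qed simp
  moreover have "derived_algebra (span {m}) \<subseteq> {0}"
  proof (rule derived_algebra_subset)
    fix x y assume "x \<in> span {m}" "y \<in> span {m}"
    then obtain j k where "x = j *\<^sub>R m" "y = k *\<^sub>R m" by (auto simp: span_singleton)
    then show "bracket x y \<in> {0}"
      by (simp add: bilinear_lmul[OF bilinear_bracket] bilinear_rmul[OF bilinear_bracket])
  qed simp
  ultimately have "(derived_algebra ^^ Suc (Suc 0)) v \<subseteq> {0}"
    by simp (meson derived_algebra_mono subset_trans)
  then show False using lie_solvable_if_derived subspace_0 assms by blast
qed

lemma semisimple_part_subset_derived: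
  assumes "\<And>q. \<exists>a. comb a q \<in> v"
  shows "comb 0 q \<in> derived_algebra v"
proof -
  have br: "comb 0 (sc (cross3 p q)) \<in> derived_algebra v" for p q
    using assms[of p] assms[of q] bracket_in_derived_algebra bracket_comb by metis
  \<comment> \<open>Each axis is the cross product of the next two in cyclic order; dividing by the
    constants undoes \<open>sc\<close>.\<close>
  have "comb 0 q = comb 0 (sc (cross3 (axis 2 1) (axis 3 (q$1 / c1)))) + comb 0 (sc (cross3 (axis 3 1) (axis 1 (q$2 / c2))))
     + comb 0 (sc (cross3 (axis 1 1) (axis 2 (q$3 / c3))))"
    using c_nz by (simp add: comb_def sc_def cross3_def vector_3 axis_def)
  then show ?thesis using br by (auto intro!: subspace_add subspace_derived_algebra)
qed

lemma eq_span_if_levi: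
  assumes v: "subspace v" "v \<subseteq> span {Z, X1, X2, X3}" "\<not> lie_solvable v"
    and br: "\<And>x y. x \<in> v \<Longrightarrow> y \<in> v \<Longrightarrow> bracket x y \<in> v"
    and a: "lie_ideal a v" "a \<noteq> {0}" "\<And>x y. x \<in> a \<Longrightarrow> y \<in> a \<Longrightarrow> bracket x y = 0"
  shows "v = span {Z, X1, X2, X3}"
proof -
  have "derived_algebra v \<subseteq> v" using v br by (intro derived_algebra_subset)
  then have X: "comb 0 q \<in> v" for q
    using semisimple_part_subset_derived projection_surj_if_not_solvable[OF v] by blast
  have sa: "subspace a" "a \<subseteq> v" using a by (auto simp: lie_ideal_def)
  obtain x where x: "x \<in> a" "x \<noteq> 0" using a(2) subspace_0[OF sa(1)] by blast
  obtain r p where rp: "x = comb r p" using x sa v in_span_iff by blast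
  have ab: "sc (cross3 (sc (cross3 q p)) p) = 0" for q
  proof -
    have "bracket (comb 0 q) x \<in> a" using a(1) X x by (simp add: lie_ideal_def)
    then have "bracket (bracket (comb 0 q) x) x = 0" using a(3) x by blast
    then show ?thesis by (simp add: rp bracket_comb comb_eq_0_iff)
  qed
  have nz: "sc q = 0 \<Longrightarrow> q = 0" for q
    using c_nz by (simp add: sc_def vec_eq_iff forall_3 vector_3)
  have ab': "cross3 (sc (cross3 q p)) p = 0" for q using nz[OF ab] .
  \<comment> \<open>The three axes give p_i p_j = 0 for distinct i, j, so at most one coordinate is
    nonzero, and equations such as c2 p3^2 + c3 p2^2 = 0 remove it, for mixed signs too.\<close>
  have "p = 0"
    using ab'[of "axis 1 1"] ab'[of "axis 2 1"] ab'[of "axis 3 1"] c_nz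
    by (simp add: cross3_def sc_def vec_eq_iff forall_3 vector_3 axis_def) (auto)
  then have "r \<noteq> 0" using rp x by auto
  moreover have "comb r 0 \<in> v" using rp \<open>p = 0\<close> x sa by auto
  ultimately have Z: "comb s 0 \<in> v" for s
    using subspace_scale[OF v(1), of "comb r 0" "s / r"] by (simp add: comb_scale)
  have "comb s q \<in> v" for s q
    using subspace_add[OF v(1) Z[of s] X[of q]] by (simp add: comb_add)
  then show ?thesis using v(2) in_span_iff by auto
qed

lemma levi_decomposable_span: "levi_decomposable (span {Z, X1, X2, X3})"
proof -
  let ?v = "span {Z, X1, X2, X3}"
  \<comment> \<open>Every term of the derived series still projects onto the simple part, so by
    induction it contains that part.\<close>
  have "comb 0 q \<in> (derived_algebra ^^ n) ?v" for n q
  proof (induction n arbitrary: q)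
    case 0
    show ?case using in_span_iff by auto
  next
    case (Suc n)
    then show ?case
      by (simp only: funpow.simps comp_def) (rule semisimple_part_subset_derived, blast)
  qed
  then have "X1 \<in> (derived_algebra ^^ n) ?v" for n by (metis comb_generators(2))
  moreover have "X1 \<noteq> 0" using comb_eq_0_iff[of 0 "axis 1 1"] by (simp add: comb_generators axis_eq_0_iff)
  ultimately have "\<not> lie_solvable ?v" unfolding lie_solvable_def by blast
  moreover have "\<not> lie_semisimple ?v"
  proof
    have Zs: "x \<in> span {Z} \<Longrightarrow> \<exists>a. x = comb a 0" for x
      by (auto simp: span_singleton comb_def)
    have br0: "bracket x y = 0" if x: "x \<in> ?v" and y: "y \<in> span {Z}" for x y
    proof -
      obtain a p where "x = comb a p" using x in_span_iff by blast
      moreover obtain b where "y = comb b 0" using Zs[OF y] by blast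
      ultimately show ?thesis by (simp add: bracket_comb sc_zero)
    qed
    have sub: "span {Z} \<subseteq> ?v" by (rule span_mono) simp
    have "derived_algebra (span {Z}) \<subseteq> {0}"
      by (rule derived_algebra_subset) (use br0 sub in auto)
    then have "lie_solvable (span {Z})"
      using lie_solvable_if_derived[of "Suc 0" "span {Z}"] by (simp add: span_0)
    moreover have "lie_ideal (span {Z}) ?v"
      using sub br0 by (simp add: lie_ideal_def span_0)
    ultimately have "Z \<in> radical ?v" unfolding radical_def by (intro span_base) (auto intro: span_base)
    moreover assume "lie_semisimple ?v"
    ultimately have "Z = 0" by (simp add: lie_semisimple_def)
    moreover have "Z \<noteq> 0" using comb_eq_0_iff[of 1 0] unfolding comb_generators by simp
    ultimately show False by contradiction
  qed
  ultimately show ?thesis by (simp add: levi_decomposable_def)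
qed

end

section \<open>Transport of Lie-theoretic notions along conjugation\<close>

lemma SU21_inverse:
  assumes "g \<in> SU21"
  shows "g ** matrix_inv g = mat 1" "matrix_inv g ** g = mat 1"
proof -
  have "invertible g" using assms by (simp add: SU21_def invertible_det_nz)
  then have "\<exists>h. g ** h = mat 1 \<and> h ** g = mat 1" by (simp add: invertible_def)
  then have "g ** matrix_inv g = mat 1 \<and> matrix_inv g ** g = mat 1"
    unfolding matrix_inv_def by (rule someI_ex)
  then show "g ** matrix_inv g = mat 1" "matrix_inv g ** g = mat 1" by auto
qed

lemma derived_algebra_image:
  assumes "linear f" "\<And>x y. f (bracket x y) = bracket (f x) (f y)"
  shows "derived_algebra (f ` v) = f ` derived_algebra v"
proof -
  have "{bracket x y |x y. x \<in> f ` v \<and> y \<in> f ` v} = f ` {bracket x y |x y. x \<in> v \<and> y \<in> v}"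
    using assms(2) by (auto simp: image_iff) metis+
  then show ?thesis using linear_span_image[OF assms(1)] by (simp add: derived_algebra_def)
qed

lemma lie_solvable_image:
  assumes "linear f" "inj f" "\<And>x y. f (bracket x y) = bracket (f x) (f y)" "lie_solvable (f ` v)"
  shows "lie_solvable v"
proof -
  have "(derived_algebra ^^ n) (f ` v) = f ` (derived_algebra ^^ n) v" for n
    by (induction n) (simp_all add: derived_algebra_image[OF assms(1,3)])
  then obtain n where "f ` (derived_algebra ^^ n) v = f ` {0}"
    using assms(4) linear_0[OF assms(1)] by (auto simp: lie_solvable_def)
  then have "(derived_algebra ^^ n) v = {0}" using assms(2) by (simp only: inj_image_eq_iff)
  then show ?thesis by (auto simp: lie_solvable_def)
qed

lemma lie_ideal_image:
  assumes "linear f" "\<And>x y. f (bracket x y) = bracket (f x) (f y)" "lie_ideal a v"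
  shows "lie_ideal (f ` a) (f ` v)"
  unfolding lie_ideal_def
proof (intro conjI ballI)
  show "f ` a \<subseteq> f ` v" "subspace (f ` a)"
    using assms(1,3) by (auto simp: lie_ideal_def linear_subspace_image)
  fix x y assume "x \<in> f ` v" "y \<in> f ` a"
  then obtain x' y' where "x' \<in> v" "x = f x'" "y' \<in> a" "y = f y'" by blast
  then show "bracket x y \<in> f ` a"
    using assms(3) by (auto simp: lie_ideal_def simp flip: assms(2))
qed

lemma conjugation_hom:
  assumes "g ** h = mat 1" "h ** g = mat 1"
  defines "f \<equiv> \<lambda>x. g ** x ** h"
  shows "linear f" "inj f" "f (bracket x y) = bracket (f x) (f y)"
proof -
  show "linear f"
    by (rule linearI) (simp_all add: f_def matrix_ring_simps)
  have "h ** f x ** g = x" for x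
    using assms by (simp add: f_def matrix_mul_assoc) (simp add: matrix_mul_assoc[symmetric])
  then show "inj f" by (metis injI)
  have cancel: "h ** (g ** m) = m" for m using assms by (simp add: matrix_mul_assoc)
  show "f (bracket x y) = bracket (f x) (f y)"
    by (simp add: f_def bracket_def matrix_ring_simps matrix_mul_assoc[symmetric] cancel)
qed

section \<open>The two stabilisers in coordinates\<close>

lemmas A_defs = A1_def A2_def A3_def A4_def A5_def A6_def

lemma A_nth:
  "A1 $ i $ j = (if i = j then if i = 1 then \<i> else if i = 2 then -\<i> else 0 else 0)"
  "A2 $ i $ j = (if i = j then if i = 2 then \<i> else if i = 3 then -\<i> else 0 else 0)"
  "A3 $ i $ j = (if i = 1 \<and> j = 2 then 1 else if i = 2 \<and> j = 1 then -1 else 0)"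
  "A4 $ i $ j = (if i = 1 \<and> j = 2 \<or> i = 2 \<and> j = 1 then \<i> else 0)"
  "A5 $ i $ j = (if i = 1 \<and> j = 3 \<or> i = 3 \<and> j = 1 then 1 else 0)"
  "A6 $ i $ j = (if i = 1 \<and> j = 3 then \<i> else if i = 3 \<and> j = 1 then -\<i> else 0)"
  by (simp_all add: A_defs cscale_def E_nth)

text \<open>The central element is i diag(1,-2,1), scalar on the plane of the first and third axes.
  The other three generators form su(1,1), whence the negative constant.\<close>

interpretation V43: one_dim_center "A1 - A2" "A1 + A2" A5 A6 "-2" 2 2
proof
  fix a b c d :: real
  assume "a *\<^sub>R (A1 - A2) + b *\<^sub>R (A1 + A2) + c *\<^sub>R A5 + d *\<^sub>R A6 = 0"
  then have "(a *\<^sub>R (A1 - A2) + b *\<^sub>R (A1 + A2) + c *\<^sub>R A5 + d *\<^sub>R A6) $ i $ j = 0" for i j by simp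
  from this[of 1 1] this[of 2 2] this[of 1 3]
  show "a = 0 \<and> b = 0 \<and> c = 0 \<and> d = 0" by (simp add: A_nth complex_eq_iff)
qed (simp_all add: vec_eq_iff forall_3 bracket_def matrix_matrix_mult_def sum_3 A_nth scaleR_conv_of_real)

text \<open>The central element is i diag(1,1,-2), scalar on the plane of the first two axes; the
  other three generators form su(2).\<close>

interpretation V44: one_dim_center "A1 + 2 *\<^sub>R A2" A1 A3 A4 2 2 2
proof
  fix a b c d :: real
  assume "a *\<^sub>R (A1 + 2 *\<^sub>R A2) + b *\<^sub>R A1 + c *\<^sub>R A3 + d *\<^sub>R A4 = 0"
  then have "(a *\<^sub>R (A1 + 2 *\<^sub>R A2) + b *\<^sub>R A1 + c *\<^sub>R A3 + d *\<^sub>R A4) $ i $ j = 0" for i j by simp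
  from this[of 1 1] this[of 3 3] this[of 1 2]
  show "a = 0 \<and> b = 0 \<and> c = 0 \<and> d = 0" by (simp add: A_nth complex_eq_iff)
qed (simp_all add: vec_eq_iff forall_3 bracket_def matrix_matrix_mult_def sum_3 A_nth scaleR_conv_of_real)

lemma v43_eq: "v43 = span {A1 - A2, A1 + A2, A5, A6}"
proof (rule antisym)
  let ?s = "span {A1 - A2, A1 + A2, A5, A6}"
  have "(1/2) *\<^sub>R ((A1 + A2) + (A1 - A2)) \<in> ?s" "(1/2) *\<^sub>R ((A1 + A2) - (A1 - A2)) \<in> ?s"
    by (intro span_scale span_add span_diff span_base; simp)+
  moreover have "(1/2) *\<^sub>R ((A1 + A2) + (A1 - A2)) = A1" "(1/2) *\<^sub>R ((A1 + A2) - (A1 - A2)) = A2"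
    by (simp_all add: vec_eq_iff)
  ultimately have "A1 \<in> ?s" "A2 \<in> ?s" by simp_all
  then show "v43 \<subseteq> ?s" unfolding v43_def by (intro span_minimal) (auto intro: span_base)
  show "?s \<subseteq> v43" unfolding v43_def
    by (intro span_minimal) (auto intro: span_base span_add span_diff)
qed

lemma v44_eq: "v44 = span {A1 + 2 *\<^sub>R A2, A1, A3, A4}"
proof (rule antisym)
  let ?s = "span {A1 + 2 *\<^sub>R A2, A1, A3, A4}"
  have "(1/2) *\<^sub>R ((A1 + 2 *\<^sub>R A2) - A1) \<in> ?s"
    by (intro span_scale span_diff span_base; simp)
  then have "A2 \<in> ?s" by simp
  then show "v44 \<subseteq> ?s" unfolding v44_def by (intro span_minimal) (auto intro: span_base)
  show "?s \<subseteq> v44" unfolding v44_def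
    by (intro span_minimal) (auto intro: span_base span_add span_scale)
qed

lemma A_in_su21: "A1 \<in> su21" "A2 \<in> su21" "A3 \<in> su21" "A4 \<in> su21" "A5 \<in> su21" "A6 \<in> su21"
  by (simp_all add: su21_iff A_nth)

lemma v43_subalgebra: "lie_subalgebra v43 su21"
proof -
  have "v43 \<subseteq> su21" unfolding v43_def using A_in_su21 by (intro span_minimal subspace_su21) auto
  moreover have "subspace v43" by (simp add: v43_def)
  ultimately show ?thesis using V43.bracket_in_span by (simp add: lie_subalgebra_def v43_eq)
qed

lemma v44_subalgebra: "lie_subalgebra v44 su21"
proof -
  have "v44 \<subseteq> su21" unfolding v44_def using A_in_su21 by (intro span_minimal subspace_su21) auto
  moreover have "subspace v44" by (simp add: v44_def)
  ultimately show ?thesis using V44.bracket_in_span by (simp add: lie_subalgebra_def v44_eq)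
qed

lemma matrix_mult_axis: "(x *v axis k 1) $ i = x $ i $ (k::3)" for x :: "'a::semiring_1^3^3"
  using exhaust_3[of k] by (auto simp: matrix_vector_mult_def sum_3 axis_def)

text \<open>Skewness clears the second row along with the second column, and the trace determines
  the middle entry. Four real parameters remain; the minus sign comes from the entry -i of
  \<open>A2\<close>.\<close>

lemma su21_fixing_axis_2:
  assumes "x \<in> su21" "x *v axis 2 1 = c *s axis 2 1"
  shows "x \<in> v43"
proof -
  have off: "x$1$2 = 0" "x$3$2 = 0"
    using arg_cong[OF assms(2), of "\<lambda>u. u$1"] arg_cong[OF assms(2), of "\<lambda>u. u$3"]
    unfolding matrix_mult_axis vector_smult_component by (simp_all add: axis_def)
  have "x = Im (x$1$1) *\<^sub>R A1 + (- Im (x$3$3)) *\<^sub>R A2 + Re (x$1$3) *\<^sub>R A5 + Im (x$1$3) *\<^sub>R A6"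
    using assms(1) off by (simp add: vec_eq_iff forall_3 A_nth su21_iff complex_eq_iff)
  also have "\<dots> \<in> v43" unfolding v43_def by (intro span_add span_scale span_base; simp)
  finally show ?thesis .
qed

lemma su21_fixing_axis_3:
  assumes "x \<in> su21" "x *v axis 3 1 = c *s axis 3 1"
  shows "x \<in> v44"
proof -
  have off: "x$1$3 = 0" "x$2$3 = 0"
    using arg_cong[OF assms(2), of "\<lambda>u. u$1"] arg_cong[OF assms(2), of "\<lambda>u. u$2"]
    unfolding matrix_mult_axis vector_smult_component by (simp_all add: axis_def)
  have "x = Im (x$1$1) *\<^sub>R A1 + (- Im (x$3$3)) *\<^sub>R A2 + Re (x$1$2) *\<^sub>R A3 + Im (x$1$2) *\<^sub>R A4"
    using assms(1) off by (simp add: vec_eq_iff forall_3 A_nth su21_iff complex_eq_iff)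
  also have "\<dots> \<in> v44" unfolding v44_def by (intro span_add span_scale span_base; simp)
  finally show ?thesis .
qed

section \<open>Classification up to conjugacy\<close>

lemma levi_decomposable_conjugate:
  assumes v: "lie_subalgebra v su21" and levi: "levi_decomposable v"
  shows "conjugate v v43 \<or> conjugate v v44"
proof -
  have ns: "\<not> lie_solvable v" "\<not> lie_semisimple v" using levi by (auto simp: levi_decomposable_def)
  obtain a where a: "lie_ideal a v" "a \<noteq> {0}" "\<And>x y. x \<in> a \<Longrightarrow> y \<in> a \<Longrightarrow> bracket x y = 0"
    using abelian_ideal_exists[OF v ns(2)] by blast
  obtain e where e: "invariant_line v e" using invariant_line_exists[OF v a] by blast
  have "herm e e \<noteq> 0" using solvable_if_isotropic_line[OF v e] ns by blast
  moreover have "v \<subseteq> su21" using v by (simp add: lie_subalgebra_def)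
  ultimately obtain g k where g: "g \<in> SU21" "k = 2 \<or> k = 3" "act g v \<subseteq> su21"
    "invariant_line (act g v) (axis k 1)"
    using conjugate_to_axis e by metis
  define f where "f x = g ** x ** matrix_inv g" for x
  have act: "act g v = f ` v" by (simp add: act_def f_def)
  have f: "linear f" "inj f" "\<And>x y. f (bracket x y) = bracket (f x) (f y)"
    using conjugation_hom[OF SU21_inverse[OF g(1)]] unfolding f_def by auto
  have w: "subspace (f ` v)" "\<not> lie_solvable (f ` v)"
    using v linear_subspace_image[OF f(1), of v] ns(1) lie_solvable_image[OF f, of v]
    unfolding lie_subalgebra_def by blast+
  have br: "bracket x y \<in> f ` v" if "x \<in> f ` v" "y \<in> f ` v" for x y
  proof -
    obtain x' y' where "x' \<in> v" "x = f x'" "y' \<in> v" "y = f y'" using \<open>x \<in> f ` v\<close> \<open>y \<in> f ` v\<close> by blast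
    then show ?thesis using v unfolding lie_subalgebra_def by (metis f(3) imageI)
  qed
  \<comment> \<open>The ideal is carried along with \<open>v\<close>, since it is what upgrades
    inclusion in a stabiliser to equality.\<close>
  have id: "lie_ideal (f ` a) (f ` v)" using f a(1) by (intro lie_ideal_image)
  have nz: "f ` a \<noteq> {0}"
    using a(2) f(2) linear_0[OF f(1)] by (metis image_empty image_insert inj_image_eq_iff)
  have ab: "bracket x y = 0" if "x \<in> f ` a" "y \<in> f ` a" for x y
  proof -
    obtain x' y' where xy: "x' \<in> a" "x = f x'" "y' \<in> a" "y = f y'"
      using \<open>x \<in> f ` a\<close> \<open>y \<in> f ` a\<close> by blast
    have "bracket x y = f (bracket x' y')" by (simp only: xy f(3))
    also have "\<dots> = 0" by (simp only: a(3)[OF xy(1,3)] linear_0[OF f(1)])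
    finally show ?thesis .
  qed
  have line: "\<exists>c. x *v axis k 1 = c *s axis k 1" "x \<in> su21" if "x \<in> f ` v" for x
    using g(3,4) that unfolding invariant_line_def act by blast+
  from g(2) show ?thesis
  proof
    assume "k = 2"
    then have "f ` v \<subseteq> v43" using line su21_fixing_axis_2 by blast
    then have "f ` v = v43" unfolding v43_eq using V43.eq_span_if_levi[OF w(1) _ w(2) br id nz ab] by blast
    then show ?thesis using g(1) act unfolding conjugate_def by metis
  next
    assume "k = 3"
    then have "f ` v \<subseteq> v44" using line su21_fixing_axis_3 by blast
    then have "f ` v = v44" unfolding v44_eq using V44.eq_span_if_levi[OF w(1) _ w(2) br id nz ab] by blast
    then show ?thesis using g(1) act unfolding conjugate_def by metis
  qed
qed

section \<open>The two algebras are not conjugate\<close>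

text \<open>\<open>v44\<close> is the Lie algebra of a maximal compact subgroup, the operators skew
  for the standard positive definite form as well.\<close>

lemma v44_skew_hermitian:
  assumes "x \<in> v44"
  shows "conj_transpose x = - x"
proof -
  have "v44 \<subseteq> {x. conj_transpose x = - x}"
    unfolding v44_def
  proof (rule span_minimal)
    show "subspace {x. conj_transpose x = - x}"
      by (rule subspaceI) (simp_all add: conj_transpose_def vec_eq_iff)
    show "{A1, A2, A3, A4} \<subseteq> {x. conj_transpose x = - x}"
      by (simp add: conj_transpose_def vec_eq_iff forall_3 A_nth)
  qed
  then show ?thesis using assms by blast
qed

text \<open>For skew-hermitian \<open>x\<close> the trace of x^2 is minus the sum of the squared
  absolute values of the entries.\<close>

lemma trace_square_v44: "x \<in> v44 \<Longrightarrow> Re (trace (x ** x)) \<le> 0"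
proof -
  assume x: "x \<in> v44"
  have "Re (x $ i $ j * x $ j $ i) \<le> 0" for i j
  proof -
    have "cnj (x $ j $ i) = - x $ i $ j"
      using arg_cong[OF v44_skew_hermitian[OF x], of "\<lambda>y. y $ i $ j"] by (simp add: conj_transpose_def)
    then have "x $ i $ j = - cnj (x $ j $ i)" by (metis minus_minus)
    then show ?thesis by simp
  qed
  then show ?thesis by (simp add: trace_def matrix_matrix_mult_def sum_nonpos)
qed

lemma v43_v44_not_conjugate: "\<not> conjugate v43 v44"
proof
  assume "conjugate v43 v44"
  then obtain g where g: "g \<in> SU21" "act g v43 = v44" unfolding conjugate_def by blast
  define y where "y = g ** A5 ** matrix_inv g"
  have "A5 \<in> v43" unfolding v43_def by (rule span_base) simp
  then have y: "y \<in> v44" using g(2) unfolding act_def y_def by blast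
  have cancel: "matrix_inv g ** (g ** m) = m" for m
    by (simp add: matrix_mul_assoc SU21_inverse[OF g(1)])
  have "y ** y = g ** ((A5 ** A5) ** matrix_inv g)"
    by (simp add: y_def matrix_mul_assoc[symmetric] cancel)
  then have "trace (y ** y) = trace ((A5 ** A5) ** matrix_inv g ** g)"
    by (metis trace_mul_sym)
  also have "\<dots> = trace (A5 ** A5)"
    by (simp add: matrix_mul_assoc[symmetric] SU21_inverse[OF g(1)])
  also have "\<dots> = 2" by (simp add: trace_def matrix_matrix_mult_def sum_3 A_nth)
  finally show False using trace_square_v44[OF y] by simp
qed

theorem theorem6p7:
  shows "(lie_subalgebra v43 su21 \<and> levi_decomposable v43 \<and> dim v43 = 4) \<and>
         (lie_subalgebra v44 su21 \<and> levi_decomposable v44 \<and> dim v44 = 4) \<and>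
         (\<forall>v. lie_subalgebra v su21 \<and> levi_decomposable v \<longrightarrow>
            conjugate v v43 \<or> conjugate v v44) \<and>
         \<not> conjugate v43 v44"
proof (intro conjI allI impI)
  show "levi_decomposable v43" "dim v43 = 4"
    unfolding v43_eq by (rule V43.levi_decomposable_span, rule V43.dim_span)
  show "levi_decomposable v44" "dim v44 = 4"
    unfolding v44_eq by (rule V44.levi_decomposable_span, rule V44.dim_span)
  show "conjugate v v43 \<or> conjugate v v44" if "lie_subalgebra v su21 \<and> levi_decomposable v" for v
    using that levi_decomposable_conjugate by blast
qed (fact v43_subalgebra v44_subalgebra v43_v44_not_conjugate)+

end
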